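(* Suppose that a group $G$ admits a non-elementary convergence action on a compact metrizable space $M$. Then the action is geometrically infinite if and only if the set of non-conical limit points (the set of points of $\Lambda G$ that are not conical) is uncountable.
   Context: An action of a group $G$ by homeomorphisms on a compact Hausdorff space $M$ is a convergence action if for every sequence $\{g_n\}$ of distinct elements of $G$ there are a subsequence $\{g_{n_i}\}$ and points $a,b\in M$ such that $g_{n_i}x\to b$ locally uniformly on $M\setminus\{a\}$. A sequence $\{g_n\}$ in $G$ with $g_nx\to b$ locally uniformly on $M\setminus\{a\}$ is called a convergence sequence with attracting point $b$ and repelling point $a$. The limit set $\Lambda H$ of a subgroup $H\le G$ is the set of attracting points of convergence sequences in $H$. The action is non-elementary if $\#\Lambda G>2$. A point $\xi\in M$ is conical if there is a convergence sequence $\{g_n\}$ with attracting point $b\in M$ and repelling point $\xi$ such that $\{g_n\xi\}$ converges to a point different from $b$. A point $\xi\in M$ is parabolic if its stabilizer $G_\xi$ is infinite and $\Lambda G_\xi=\{\xi\}$; a parabolic point $\xi$ is bounded parabolic if $G_\xi$ acts cocompactly on $\Lambda G\setminus\{\xi\}$. The action is geometrically finite if every point of $\Lambda G$ is conical or bounded parabolic, and geometrically infinite otherwise. *)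

theory Defs
  imports "HOL-Analysis.Analysis" "HOL-Algebra.Group_Action"
begin

text \<open>Uniform convergence to a constant \<open>b\<close> with respect to the unique uniformity of a compact
  Hausdorff space means that every neighbourhood of \<open>b\<close> eventually contains all values; no metric
  is needed. ``Locally'' is relative to the subspace \<open>S\<close>.\<close>

definition locally_uniformly_to_const ::
    "'m topology \<Rightarrow> 'm set \<Rightarrow> (nat \<Rightarrow> 'm \<Rightarrow> 'm) \<Rightarrow> 'm \<Rightarrow> bool" where
  "locally_uniformly_to_const X S f b \<longleftrightarrow>
     (\<forall>x\<in>S. \<exists>V. openin (subtopology X S) V \<and> x \<in> V \<and>
        (\<forall>U. openin X U \<and> b \<in> U \<longrightarrow> (\<forall>\<^sub>F n in sequentially. f n ` V \<subseteq> U)))"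

text \<open>Here \<open>a\<close> is the repelling and \<open>b\<close> the attracting point. The terms of the sequence are
  not required to be distinct.\<close>

definition convergence_sequence ::
    "'m topology \<Rightarrow> ('g \<Rightarrow> 'm \<Rightarrow> 'm) \<Rightarrow> 'g set \<Rightarrow> (nat \<Rightarrow> 'g) \<Rightarrow> 'm \<Rightarrow> 'm \<Rightarrow> bool" where
  "convergence_sequence X \<phi> H g a b \<longleftrightarrow>
     range g \<subseteq> H \<and> a \<in> topspace X \<and> b \<in> topspace X \<and>
     locally_uniformly_to_const X (topspace X - {a}) (\<lambda>n. \<phi> (g n)) b"

locale convergence_action = group_action G "topspace X" \<phi>
  for G :: "('g, 'c) monoid_scheme" and X :: "'m topology" and \<phi> :: "'g \<Rightarrow> 'm \<Rightarrow> 'm" +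
  assumes compact: "compact_space X"
    and Hausdorff: "Hausdorff_space X"
    and homeomorphic: "g \<in> carrier G \<Longrightarrow> homeomorphic_map X X (\<phi> g)"
    and convergence: "\<And>s :: nat \<Rightarrow> 'g. \<lbrakk>range s \<subseteq> carrier G; inj s\<rbrakk> \<Longrightarrow>
          \<exists>(r :: nat \<Rightarrow> nat) a b. strict_mono r \<and> convergence_sequence X \<phi> (carrier G) (s \<circ> r) a b"

definition limit_set :: "'m topology \<Rightarrow> ('g \<Rightarrow> 'm \<Rightarrow> 'm) \<Rightarrow> 'g set \<Rightarrow> 'm set" where
  "limit_set X \<phi> H = {b. \<exists>g a. convergence_sequence X \<phi> H g a b}"

text \<open>The disjunction is needed because \<open>card\<close> is \<open>0\<close> on infinite sets.\<close>

definition non_elementary ::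
    "('g, 'c) monoid_scheme \<Rightarrow> 'm topology \<Rightarrow> ('g \<Rightarrow> 'm \<Rightarrow> 'm) \<Rightarrow> bool" where
  "non_elementary G X \<phi> \<longleftrightarrow>
     infinite (limit_set X \<phi> (carrier G)) \<or> card (limit_set X \<phi> (carrier G)) > 2"

definition conical_point ::
    "('g, 'c) monoid_scheme \<Rightarrow> 'm topology \<Rightarrow> ('g \<Rightarrow> 'm \<Rightarrow> 'm) \<Rightarrow> 'm \<Rightarrow> bool" where
  "conical_point G X \<phi> \<xi> \<longleftrightarrow>
     (\<exists>g b c. convergence_sequence X \<phi> (carrier G) g \<xi> b \<and>
        limitin X (\<lambda>n. \<phi> (g n) \<xi>) c sequentially \<and> c \<noteq> b)"

definition parabolic_point ::
    "('g, 'c) monoid_scheme \<Rightarrow> 'm topology \<Rightarrow> ('g \<Rightarrow> 'm \<Rightarrow> 'm) \<Rightarrow> 'm \<Rightarrow> bool" where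
  "parabolic_point G X \<phi> \<xi> \<longleftrightarrow>
     \<xi> \<in> topspace X \<and> infinite (stabilizer G \<phi> \<xi>) \<and>
     limit_set X \<phi> (stabilizer G \<phi> \<xi>) = {\<xi>}"

text \<open>Cocompactness: the translates of some compact subset of \<open>Y\<close> cover \<open>Y\<close>.\<close>

definition acts_cocompactly_on ::
    "'m topology \<Rightarrow> ('g \<Rightarrow> 'm \<Rightarrow> 'm) \<Rightarrow> 'g set \<Rightarrow> 'm set \<Rightarrow> bool" where
  "acts_cocompactly_on X \<phi> H Y \<longleftrightarrow>
     (\<exists>K. compactin X K \<and> K \<subseteq> Y \<and> (\<Union>h\<in>H. \<phi> h ` K) = Y)"

definition bounded_parabolic_point ::
    "('g, 'c) monoid_scheme \<Rightarrow> 'm topology \<Rightarrow> ('g \<Rightarrow> 'm \<Rightarrow> 'm) \<Rightarrow> 'm \<Rightarrow> bool" where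
  "bounded_parabolic_point G X \<phi> \<xi> \<longleftrightarrow>
     parabolic_point G X \<phi> \<xi> \<and>
     acts_cocompactly_on X \<phi> (stabilizer G \<phi> \<xi>) (limit_set X \<phi> (carrier G) - {\<xi>})"

definition geometrically_finite ::
    "('g, 'c) monoid_scheme \<Rightarrow> 'm topology \<Rightarrow> ('g \<Rightarrow> 'm \<Rightarrow> 'm) \<Rightarrow> bool" where
  "geometrically_finite G X \<phi> \<longleftrightarrow>
     (\<forall>\<xi>\<in>limit_set X \<phi> (carrier G). conical_point G X \<phi> \<xi> \<or> bounded_parabolic_point G X \<phi> \<xi>)"

abbreviation geometrically_infinite ::
    "('g, 'c) monoid_scheme \<Rightarrow> 'm topology \<Rightarrow> ('g \<Rightarrow> 'm \<Rightarrow> 'm) \<Rightarrow> bool" where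
  "geometrically_infinite G X \<phi> \<equiv> \<not> geometrically_finite G X \<phi>"

end

theory Submission
  imports Defs
begin

text \<open>For the non-trivial direction, \<open>\<tau>(x, y) = sup\<^sub>g d(gx, gy)\<close> is a complete \<open>G\<close>-invariant metric,
  finer than \<open>d\<close>, and a \<open>\<tau>\<close>-limit of non-conical limit points is again one. If \<open>\<xi>\<close> is a
  non-conical limit point which is not bounded parabolic, then \<open>\<xi>\<close> is not \<open>\<tau>\<close>-isolated in its orbit,
  so the \<open>\<tau>\<close>-closure of the orbit is a non-empty perfect subset of a complete metric space and
  therefore uncountable.

  Conversely, if there are uncountably many bounded parabolic non-conical points, some of them converge
  to another one, \<open>p\<^sub>n \<rightarrow> p\<close>, with a uniform cocompactness constant: there are \<open>h\<^sub>n\<close> fixing \<open>p\<^sub>n\<close> with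
  \<open>h\<^sub>n p\<close> away from \<open>p\<close>. The repelling point of \<open>(h\<^sub>n)\<close> is \<open>p\<close>. If the attracting point were different
  from \<open>p\<close>, then \<open>h\<^sub>n\<close> would be loxodromic for large \<open>n\<close>, so it is \<open>p\<close>, and \<open>p\<close> is conical.\<close>

subsection \<open>Convergence sequences in metric spaces\<close>

text \<open>Closures in \<open>X\<close> cannot replace the invariant metric: every limit point,
  conical or not, lies in the closure of the orbit of \<xi> (\<open>orbit_dense\<close>). The
  supremum excludes the conical ones. If \<open>x\<close> is conical through \<open>g n\<close>,
  with attracting point \<open>b\<close> and with \<open>c\<close> the limit of
  \<open>\<phi> (g n) x\<close>, then every \<open>w \<noteq> x\<close> is carried to
  \<open>b\<close>, whence \<open>orbit_dist x w \<ge> d b c\<close>: a conical point is isolated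
  for the invariant metric. For pairs of non-conical points, finiteness is what matters: only
  finitely many elements keep them a given distance apart (\<open>finite_far_pairs\<close>), which
  permits the extremal choice in \<open>orbit_not_isolated\<close>. Bounded parabolicity concerns
  all limit points, that choice only an orbit; \<open>bounded_parabolicI\<close> mediates by
  density. In the converse, loxodromic elements never appear formally:
  \<open>parabolic_not_contracting\<close> gets its contradiction from the powers of one
  element.\<close>

lemma inj_subsequence:
  fixes s :: "nat \<Rightarrow> 'a"
  assumes "\<And>y. finite {n. s n = y}"
  obtains r where "strict_mono (r :: nat \<Rightarrow> nat)" "inj (s \<circ> r)"
proof -
  \<comment> \<open>\<open>I\<close> collects the first occurrences. Every value has one, so
    \<open>I\<close> has the same image as the whole sequence, and finite fibres force it to be
    infinite.\<close>
  define I where "I = {n. \<forall>m<n. s m \<noteq> s n}"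
  have "s n \<in> s ` I" for n
  proof (induction n rule: less_induct)
    case (less n)
    show ?case
    proof (cases "n \<in> I")
      case False
      then obtain m where "m < n" "s m = s n"
        unfolding I_def by blast
      then show ?thesis
        using less by metis
    qed auto
  qed
  then have range: "range s = s ` I"
    by blast
  have "infinite I"
  proof
    assume "finite I"
    then have "finite (range s)"
      by (simp add: range)
    then have "finite (\<Union>y\<in>range s. {n. s n = y})"
      using assms by blast
    moreover have "(\<Union>y\<in>range s. {n. s n = y}) = UNIV"
      by auto
    ultimately show False
      by simp
  qed
  then obtain r where r: "strict_mono (r :: nat \<Rightarrow> nat)" "\<And>n. r n \<in> I"
    using infinite_enumerate by blast
  have "inj (s \<circ> r)"
  proof (rule linorder_injI)
    fix m n :: nat
    assume "m < n"
    then have "r m < r n"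
      using r(1) by (simp add: strict_mono_def)
    moreover have "\<forall>k<r n. s k \<noteq> s (r n)"
      using r(2)[of n] unfolding I_def by blast
    ultimately show "(s \<circ> r) m \<noteq> (s \<circ> r) n"
      by simp
  qed
  with r(1) show ?thesis
    by (rule that)
qed

locale metric_convergence_action = convergence_action G X \<phi> + Metric_space "topspace X" d
  for G :: "('g, 'c) monoid_scheme" and X :: "'m topology" and \<phi> :: "'g \<Rightarrow> 'm \<Rightarrow> 'm"
    and d :: "'m \<Rightarrow> 'm \<Rightarrow> real" +
  assumes mtopology_eq: "mtopology = X"
begin

section \<open>Action, limits and sequential compactness in metric form\<close>

sublocale group G
  using group_hom group_hom.axioms(1) by blast

lemma act_closed [simp]: "g \<in> carrier G \<Longrightarrow> x \<in> topspace X \<Longrightarrow> \<phi> g x \<in> topspace X"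
  using element_image by blast

lemma act_inv [simp]: "g \<in> carrier G \<Longrightarrow> x \<in> topspace X \<Longrightarrow> \<phi> (inv\<^bsub>G\<^esub> g) (\<phi> g x) = x"
  using orbit_sym_aux by blast

lemma act_inv' [simp]: "g \<in> carrier G \<Longrightarrow> x \<in> topspace X \<Longrightarrow> \<phi> g (\<phi> (inv\<^bsub>G\<^esub> g) x) = x"
  using act_inv[of "inv\<^bsub>G\<^esub> g" x] by simp

lemma act_eq_iff: "g \<in> carrier G \<Longrightarrow> x \<in> topspace X \<Longrightarrow> y \<in> topspace X \<Longrightarrow> \<phi> g x = \<phi> g y \<longleftrightarrow> x = y"
  using act_inv by metis

lemma act_limit:
  assumes "g \<in> carrier G" "limitin X x l sequentially"
  shows "limitin X (\<lambda>n. \<phi> g (x n)) (\<phi> g l) sequentially"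
  using continuous_map_limit[OF homeomorphic_imp_continuous_map[OF homeomorphic[OF assms(1)]] assms(2)]
  by (simp add: o_def)

lemma limitin_dist_iff:
  "limitin X x l sequentially \<longleftrightarrow>
    l \<in> topspace X \<and> (\<forall>e>0. \<forall>\<^sub>F n in sequentially. x n \<in> topspace X \<and> d (x n) l < e)"
  using limitin_metric[of x l sequentially] by (simp add: mtopology_eq)

lemma limit_unique:
  "limitin X x l sequentially \<Longrightarrow> limitin X x l' sequentially \<Longrightarrow> l = l'"
  using limitin_metric_unique[of x l sequentially l'] by (simp add: mtopology_eq)

lemma convergent_subsequence:
  assumes "\<And>n. x n \<in> topspace X"
  obtains l r where "strict_mono (r :: nat \<Rightarrow> nat)" "limitin X (x \<circ> r) l sequentially"
proof -
  have "compactin X (topspace X)"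
    using compact by (simp add: compact_space_def)
  then have "\<forall>\<sigma>::nat \<Rightarrow> 'm. range \<sigma> \<subseteq> topspace X \<longrightarrow>
      (\<exists>l r. l \<in> topspace X \<and> strict_mono r \<and> limitin X (\<sigma> \<circ> r) l sequentially)"
    unfolding compactin_sequentially[unfolded mtopology_eq] by (rule conjunct2)
  moreover have "range x \<subseteq> topspace X"
    using assms by auto
  ultimately obtain l r where "strict_mono (r :: nat \<Rightarrow> nat)" "limitin X (x \<circ> r) l sequentially"
    by blast
  then show ?thesis
    by (rule that)
qed

text \<open>Metric form of locally uniform convergence to \<open>b\<close> off \<open>a\<close>: it is visibly symmetric under
  exchanging \<open>(g n, a, b)\<close> and \<open>(inv (g n), b, a)\<close>.\<close>

definition conv :: "(nat \<Rightarrow> 'g) \<Rightarrow> 'm \<Rightarrow> 'm \<Rightarrow> bool" where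
  "conv g a b \<longleftrightarrow> range g \<subseteq> carrier G \<and> a \<in> topspace X \<and> b \<in> topspace X \<and>
    (\<forall>r>0. \<forall>\<^sub>F n in sequentially. \<forall>x\<in>topspace X. r \<le> d a x \<longrightarrow> d b (\<phi> (g n) x) < r)"

lemma conv_carrier: "conv g a b \<Longrightarrow> g n \<in> carrier G"
  unfolding conv_def by blast

lemma conv_topspace: "conv g a b \<Longrightarrow> a \<in> topspace X" "conv g a b \<Longrightarrow> b \<in> topspace X"
  unfolding conv_def by blast+

lemma conv_subsequence:
  assumes "conv g a b" "strict_mono (r :: nat \<Rightarrow> nat)"
  shows "conv (g \<circ> r) a b"
  using assms unfolding conv_def by (auto intro: eventually_subseq)

text \<open>In \<open>conv\<close> the same \<open>r\<close> is excluded radius and accuracy, so the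
  contrapositive of its condition, taken at the preimage of \<open>x\<close> under
  \<open>g n\<close>, is the condition for the inverses.\<close>

lemma conv_inv:
  assumes "conv g a b"
  shows "conv (\<lambda>n. inv\<^bsub>G\<^esub> (g n)) b a"
  unfolding conv_def
proof (intro conjI allI impI)
  show "range (\<lambda>n. inv\<^bsub>G\<^esub> (g n)) \<subseteq> carrier G"
    using conv_carrier[OF assms] by auto
  show "a \<in> topspace X" "b \<in> topspace X"
    using assms conv_topspace by auto
  fix r :: real
  assume "r > 0"
  then have "\<forall>\<^sub>F n in sequentially. \<forall>x\<in>topspace X. r \<le> d a x \<longrightarrow> d b (\<phi> (g n) x) < r"
    using assms unfolding conv_def by blast
  then show "\<forall>\<^sub>F n in sequentially. \<forall>x\<in>topspace X. r \<le> d b x \<longrightarrow> d a (\<phi> (inv\<^bsub>G\<^esub> (g n)) x) < r"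
  proof eventually_elim
    case (elim n)
    show ?case
    proof (intro ballI impI)
      fix x
      assume x: "x \<in> topspace X" "r \<le> d b x"
      have "g n \<in> carrier G"
        using assms conv_carrier by blast
      then show "d a (\<phi> (inv\<^bsub>G\<^esub> (g n)) x) < r"
        using elim[rule_format, of "\<phi> (inv\<^bsub>G\<^esub> (g n)) x"] x
        by (metis act_closed act_inv' inv_closed leI not_le)
    qed
  qed
qed

lemma conv_limit:
  assumes g: "conv g a b" and x: "limitin X x p sequentially" and "p \<noteq> a"
  shows "limitin X (\<lambda>n. \<phi> (g n) (x n)) b sequentially"
  unfolding limitin_dist_iff
proof (intro conjI allI impI)
  show "b \<in> topspace X"
    using g conv_topspace by blast
  have p: "p \<in> topspace X"
    using x by (rule limitin_topspace)
  have a: "a \<in> topspace X"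
    using g by (rule conv_topspace)
  fix e :: real
  assume "e > 0"
  \<comment> \<open>Half of \<open>d a p\<close> keeps \<open>x n\<close>, once it is within
    \<open>r\<close> of \<open>p\<close>, at least \<open>r\<close> away from \<open>a\<close>; the
    bound \<open>e\<close> serves the conclusion.\<close>
  define r where "r = min e (d a p / 2)"
  have "d a p > 0"
    using p a \<open>p \<noteq> a\<close> by simp
  then have "r > 0" "r \<le> e" "r \<le> d a p / 2"
    using \<open>e > 0\<close> by (auto simp: r_def)
  have "\<forall>\<^sub>F n in sequentially. \<forall>x\<in>topspace X. r \<le> d a x \<longrightarrow> d b (\<phi> (g n) x) < r"
    using g \<open>r > 0\<close> unfolding conv_def by blast
  moreover have "\<forall>\<^sub>F n in sequentially. x n \<in> topspace X \<and> d (x n) p < r"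
    using x \<open>r > 0\<close> unfolding limitin_dist_iff by blast
  ultimately show "\<forall>\<^sub>F n in sequentially. \<phi> (g n) (x n) \<in> topspace X \<and> d (\<phi> (g n) (x n)) b < e"
  proof eventually_elim
    case (elim n)
    have "d a p \<le> d a (x n) + d (x n) p"
      using elim a p triangle by blast
    then have "r \<le> d a (x n)"
      using elim \<open>r \<le> d a p / 2\<close> by linarith
    then have "d b (\<phi> (g n) (x n)) < r"
      using elim by blast
    then show ?case
      using elim \<open>r \<le> e\<close> conv_carrier[OF g] by (simp add: commute)
  qed
qed

lemma conv_limit_const:
  assumes "conv g a b" "x \<in> topspace X" "x \<noteq> a"
  shows "limitin X (\<lambda>n. \<phi> (g n) x) b sequentially"
  using assms by (intro conv_limit) auto

text \<open>Forwards, the complement of a ball around \<open>a\<close> is compact, so finitely many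
  of the given neighbourhoods cover it. Backwards, the points farther from \<open>a\<close> than
  half of \<open>d a x\<close> form one neighbourhood of \<open>x\<close> that works for every
  \<open>U\<close>.\<close>

lemma convergence_sequence_iff:
  assumes H: "H \<subseteq> carrier G"
  shows "convergence_sequence X \<phi> H g a b \<longleftrightarrow> range g \<subseteq> H \<and> conv g a b"
proof
  assume L: "convergence_sequence X \<phi> H g a b"
  then have g: "range g \<subseteq> H" "a \<in> topspace X" "b \<in> topspace X"
    and loc: "locally_uniformly_to_const X (topspace X - {a}) (\<lambda>n. \<phi> (g n)) b"
    unfolding convergence_sequence_def by auto
  have "\<forall>\<^sub>F n in sequentially. \<forall>x\<in>topspace X. r \<le> d a x \<longrightarrow> d b (\<phi> (g n) x) < r" if "r > 0" for r
  proof -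
    define K where "K = topspace X - mball a r"
    have opn: "openin X (topspace X - {a})"
      using Hausdorff by (metis Hausdorff_imp_t1_space t1_space_openin_delete_alt openin_topspace)
    have "closedin X K"
      unfolding K_def using openin_mball[of a r] by (simp add: mtopology_eq closedin_diff)
    then have K: "compactin X K"
      using compact closedin_compact_space by blast
    define U where "U = mball b r"
    have U: "openin X U" "b \<in> U"
      using openin_mball[of b r] \<open>r > 0\<close> g by (auto simp: U_def mtopology_eq)
    have "\<exists>V. openin X V \<and> x \<in> V \<and> (\<forall>\<^sub>F n in sequentially. \<phi> (g n) ` V \<subseteq> U)" if "x \<in> K" for x
    proof -
      have "x \<in> topspace X - {a}"
        using that g \<open>r > 0\<close> by (auto simp: K_def)
      then obtain V where "openin (subtopology X (topspace X - {a})) V" "x \<in> V"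
        "\<forall>\<^sub>F n in sequentially. \<phi> (g n) ` V \<subseteq> U"
        using loc U unfolding locally_uniformly_to_const_def by blast
      then show ?thesis
        using openin_trans_full opn by blast
    qed
    then obtain V where V: "\<And>x. x \<in> K \<Longrightarrow> openin X (V x) \<and> x \<in> V x"
      "\<And>x. x \<in> K \<Longrightarrow> \<forall>\<^sub>F n in sequentially. \<phi> (g n) ` V x \<subseteq> U"
      by metis
    have "K \<subseteq> \<Union> (V ` K)" "\<forall>W\<in>V ` K. openin X W"
      using V by blast+
    then obtain F where "finite F" "F \<subseteq> V ` K" "K \<subseteq> \<Union> F"
      using K unfolding compactin_def by meson
    then obtain K' where K': "finite K'" "K' \<subseteq> K" "K \<subseteq> \<Union> (V ` K')"
      by (metis finite_subset_image)
    have "\<forall>\<^sub>F n in sequentially. \<forall>x\<in>K'. \<phi> (g n) ` V x \<subseteq> U"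
      using K' V by (intro eventually_ball_finite) auto
    then show ?thesis
    proof eventually_elim
      case (elim n)
      show ?case
      proof (intro ballI impI)
        fix x
        assume "x \<in> topspace X" "r \<le> d a x"
        then have "x \<in> K"
          by (auto simp: K_def)
        then have "\<phi> (g n) x \<in> U"
          using K' elim by blast
        then show "d b (\<phi> (g n) x) < r"
          by (simp add: U_def)
      qed
    qed
  qed
  then show "range g \<subseteq> H \<and> conv g a b"
    unfolding conv_def using g H by blast
next
  assume R: "range g \<subseteq> H \<and> conv g a b"
  have "\<exists>V. openin (subtopology X (topspace X - {a})) V \<and> x \<in> V \<and>
      (\<forall>U. openin X U \<and> b \<in> U \<longrightarrow> (\<forall>\<^sub>F n in sequentially. \<phi> (g n) ` V \<subseteq> U))"
    if x: "x \<in> topspace X - {a}" for x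
  proof -
    have a: "a \<in> topspace X"
      using R conv_topspace by blast
    define e where "e = d a x / 2"
    have "e > 0"
      using x a by (auto simp: e_def)
    define V where "V = topspace X - mcball a e"
    have "openin X V"
      unfolding V_def using closedin_mcball[of a e] by (simp add: mtopology_eq openin_diff)
    moreover have "V \<subseteq> topspace X - {a}"
      using a \<open>e > 0\<close> by (auto simp: V_def)
    ultimately have "openin (subtopology X (topspace X - {a})) V"
      unfolding openin_subtopology by blast
    moreover have "x \<in> V"
      using x \<open>e > 0\<close> by (auto simp: V_def e_def)
    moreover have "\<forall>\<^sub>F n in sequentially. \<phi> (g n) ` V \<subseteq> U" if U: "openin X U" "b \<in> U" for U
    proof -
      obtain s where s: "s > 0" "mball b s \<subseteq> U"
        using U openin_mtopology[unfolded mtopology_eq, of U] by blast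
      define r where "r = min s e"
      have "r > 0"
        using s \<open>e > 0\<close> by (simp add: r_def)
      then have "\<forall>\<^sub>F n in sequentially. \<forall>x\<in>topspace X. r \<le> d a x \<longrightarrow> d b (\<phi> (g n) x) < r"
        using R unfolding conv_def by blast
      then show ?thesis
      proof eventually_elim
        case (elim n)
        show ?case
        proof
          fix y
          assume "y \<in> \<phi> (g n) ` V"
          then obtain z where z: "z \<in> V" "y = \<phi> (g n) z"
            by blast
          then have zt: "z \<in> topspace X" and "r \<le> d a z"
            using a by (auto simp: V_def r_def)
          then have "d b y < s"
            using elim z by (auto simp: r_def)
          moreover have "y \<in> topspace X" "b \<in> topspace X"
            using zt z(2) R conv_carrier conv_topspace by auto
          ultimately show "y \<in> U"
            using s(2) by auto
        qed
      qed
    qed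
    ultimately show ?thesis
      by blast
  qed
  then show "convergence_sequence X \<phi> H g a b"
    using R conv_topspace[of g a b]
    by (simp add: convergence_sequence_def locally_uniformly_to_const_def)
qed

lemma exists_conv_subsequence:
  assumes "\<And>n. s n \<in> carrier G" "\<And>g. finite {n. s n = g}"
  obtains r a b where "strict_mono (r :: nat \<Rightarrow> nat)" "conv (s \<circ> r) a b"
proof -
  obtain r where r: "strict_mono (r :: nat \<Rightarrow> nat)" "inj (s \<circ> r)"
    by (rule inj_subsequence[of s, OF assms(2)])
  moreover have "range (s \<circ> r) \<subseteq> carrier G"
    using assms(1) by auto
  ultimately obtain r' a b where "strict_mono (r' :: nat \<Rightarrow> nat)"
    "convergence_sequence X \<phi> (carrier G) ((s \<circ> r) \<circ> r') a b"
    using convergence[of "s \<circ> r"] by auto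
  then show ?thesis
    using that[of "r \<circ> r'" a b] r(1) convergence_sequence_iff[of "carrier G"]
    by (simp add: o_assoc strict_mono_o)
qed

end

subsection \<open>Countably many bounded parabolic points\<close>

locale nonelementary_metric_action = metric_convergence_action G X \<phi> d
  for G :: "('g, 'c) monoid_scheme" and X :: "'m topology" and \<phi> :: "'g \<Rightarrow> 'm \<Rightarrow> 'm"
    and d :: "'m \<Rightarrow> 'm \<Rightarrow> real" +
  assumes non_elementary: "non_elementary G X \<phi>"
begin

abbreviation limit_points :: "'m set" ("\<Lambda>")
  where "\<Lambda> \<equiv> limit_set X \<phi> (carrier G)"

abbreviation conical :: "'m \<Rightarrow> bool"
  where "conical \<equiv> conical_point G X \<phi>"

lemma limit_set_iff:
  "H \<subseteq> carrier G \<Longrightarrow> b \<in> limit_set X \<phi> H \<longleftrightarrow> (\<exists>g a. range g \<subseteq> H \<and> conv g a b)"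
  unfolding limit_set_def by (simp add: convergence_sequence_iff)

lemma limit_points_iff: "b \<in> \<Lambda> \<longleftrightarrow> (\<exists>g a. conv g a b)"
  by (auto simp: limit_set_iff conv_def)

lemma limit_points_subset: "\<Lambda> \<subseteq> topspace X"
  by (auto simp: limit_points_iff conv_topspace)

lemma stabilizerD: "g \<in> stabilizer G \<phi> x \<Longrightarrow> g \<in> carrier G" "g \<in> stabilizer G \<phi> x \<Longrightarrow> \<phi> g x = x"
  unfolding stabilizer_def by auto

lemma exists_third_limit_point:
  obtains z where "z \<in> \<Lambda>" "z \<noteq> x" "z \<noteq> y"
proof -
  have "\<not> \<Lambda> \<subseteq> {x, y}"
  proof
    assume L: "\<Lambda> \<subseteq> {x, y}"
    then have "card \<Lambda> \<le> card {x, y}" "finite \<Lambda>"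
      by (auto intro: card_mono finite_subset)
    moreover have "card {x, y} \<le> 2"
      by (simp add: card_insert_if)
    ultimately show False
      using non_elementary unfolding non_elementary_def by linarith
  qed
  then show ?thesis
    using that by blast
qed

lemma exists_third_point:
  obtains z where "z \<in> topspace X" "z \<noteq> x" "z \<noteq> y"
  using exists_third_limit_point[of x y] limit_points_subset by blast

lemma not_conicalD:
  assumes "\<not> conical \<xi>" "conv g \<xi> b" "limitin X (\<lambda>n. \<phi> (g n) \<xi>) c sequentially"
  shows "c = b"
  using assms convergence_sequence_iff[of "carrier G" g \<xi> b]
  unfolding conical_point_def conv_def by blast

text \<open>Otherwise \<open>h\<close> maps the complement of a neighbourhood of \<open>a\<close> and \<open>p\<close> into a small ball
  around \<open>b\<close>, so its powers are distinct and accumulate at a point other than \<open>p\<close>.\<close>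

lemma parabolic_not_contracting:
  assumes p: "parabolic_point G X \<phi> p" and h: "h \<in> stabilizer G \<phi> p"
    and a: "a \<in> topspace X" and b: "b \<in> topspace X" and z: "z \<in> topspace X"
    and e: "2 * e \<le> d a b" "e \<le> d a z" "e \<le> d b z" "d a p < e"
  shows "\<exists>x\<in>topspace X. e \<le> d a x \<and> e \<le> d b (\<phi> h x)"
proof (rule ccontr)
  assume "\<not> ?thesis"
  then have contract: "\<And>x. x \<in> topspace X \<Longrightarrow> e \<le> d a x \<Longrightarrow> d b (\<phi> h x) < e"
    by force
  have pt: "p \<in> topspace X"
    using p unfolding parabolic_point_def by blast
  have e0: "e > 0"
    using e a pt nonneg[of a p] by linarith
  have hG: "h \<in> carrier G"
    using h by (rule stabilizerD)
  \<comment> \<open>Exponents start at 1, so every \<open>s k\<close> sends the points at least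
    \<open>e\<close> from \<open>a\<close> into the \<open>e\<close>-ball around \<open>b\<close>.
    As \<open>z\<close> is such a point outside that ball, no \<open>s k\<close> is the
    identity.\<close>
  define s where "s k = h [^]\<^bsub>G\<^esub> Suc k" for k :: nat
  have sG: "s k \<in> carrier G" for k
    using hG by (simp add: s_def)
  have s_Suc: "\<phi> (s (Suc k)) x = \<phi> h (\<phi> (s k) x)" if "x \<in> topspace X" for k x
  proof -
    have "s (Suc k) = h \<otimes>\<^bsub>G\<^esub> s k"
      unfolding s_def using hG by (rule nat_pow_Suc2)
    then show ?thesis
      using composition_rule[OF that hG sG[of k]] by simp
  qed
  have s_0: "\<phi> (s 0) x = \<phi> h x" for x
    using hG by (simp add: s_def)
  \<comment> \<open>By \<open>2 * e \<le> d a b\<close> the \<open>e\<close>-ball around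
    \<open>b\<close> lies in the region where \<open>h\<close> contracts, so the contraction can be
    iterated.\<close>
  have far: "e \<le> d a y" if "y \<in> topspace X" "d b y < e" for y
    using triangle[OF a that(1) b] commute[of y b] that e by linarith
  have sx: "d b (\<phi> (s k) x) < e" if "x \<in> topspace X" "e \<le> d a x" for x k
  proof (induction k)
    case 0
    then show ?case
      using contract that by (simp add: s_0)
  next
    case (Suc k)
    then show ?case
      using contract[of "\<phi> (s k) x"] far[of "\<phi> (s k) x"] that sG by (simp add: s_Suc)
  qed
  have s_add: "s (Suc (i + j)) = s i \<otimes>\<^bsub>G\<^esub> s j" for i j
    by (simp only: s_def nat_pow_mult[OF hG] add_Suc add_Suc_right)
  have "inj s"
  proof (rule linorder_injI)
    fix i j :: nat
    assume "i < j"
    then obtain k where k: "j = Suc (i + k)"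
      using less_iff_Suc_add by blast
    show "s i \<noteq> s j"
    proof
      assume "s i = s j"
      then have "s k = \<one>\<^bsub>G\<^esub>"
        using sG s_add[of i k] k l_cancel_one'[of "s i" "s k"] by simp
      then have "\<phi> (s k) z = z"
        using z id_eq_one by (metis restrict_apply')
      then show False
        using sx[of z k] z e by auto
    qed
  qed
  then have fin: "finite {n. s n = g}" for g
    using finite_vimageI[of "{g}" s] by (simp add: vimage_def)
  obtain r a' b' where r: "strict_mono (r :: nat \<Rightarrow> nat)" and c: "conv (s \<circ> r) a' b'"
    by (rule exists_conv_subsequence[of s, OF sG fin])
  have "s k \<in> stabilizer G \<phi> p" for k
  proof (induction k)
    case 0
    then show ?case
      using h hG by (simp add: s_def)
  next
    case (Suc k)
    then show ?case
      using pt sG s_Suc h unfolding stabilizer_def by simp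
  qed
  then have "range (s \<circ> r) \<subseteq> stabilizer G \<phi> p"
    by auto
  then have "b' \<in> limit_set X \<phi> (stabilizer G \<phi> p)"
    using c limit_set_iff[OF stabilizer_subset] by blast
  then have "b' = p"
    using p unfolding parabolic_point_def by blast
  have "b \<noteq> z"
    using e e0 b z by auto
  \<comment> \<open>Both \<open>b\<close> and \<open>z\<close> are at least \<open>e\<close> from
    \<open>a\<close>, and one of them is not the repelling point \<open>a'\<close>.\<close>
  then obtain x where x: "x \<in> topspace X" "x \<noteq> a'" "e \<le> d a x"
    using b z e e0 by (metis mult_2 less_add_same_cancel1 order.strict_implies_order order_trans)
  then have "limitin X (\<lambda>n. \<phi> ((s \<circ> r) n) x) p sequentially"
    using conv_limit_const[OF c] \<open>b' = p\<close> by blast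
  \<comment> \<open>Points within \<delta> of \<open>p\<close> are within \<open>e\<close> of
    \<open>a\<close>, where no \<open>\<phi> (s k) x\<close> can lie.\<close>
  moreover define \<delta> where "\<delta> = e - d a p"
  moreover have "\<delta> > 0"
    using e by (simp add: \<delta>_def)
  ultimately have "\<forall>\<^sub>F n in sequentially. \<phi> ((s \<circ> r) n) x \<in> topspace X \<and> d (\<phi> ((s \<circ> r) n) x) p < \<delta>"
    unfolding limitin_dist_iff by blast
  then obtain n where n: "\<phi> ((s \<circ> r) n) x \<in> topspace X" "d (\<phi> ((s \<circ> r) n) x) p < \<delta>"
    by (auto simp: eventually_sequentially)
  define y where "y = \<phi> ((s \<circ> r) n) x"
  have "d b y < e"
    using sx[of x] x by (simp add: y_def)
  then have "e \<le> d a y"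
    using far n y_def by blast
  moreover have "d a y \<le> d a p + d p y"
    using triangle a pt n y_def by blast
  ultimately show False
    using n commute[of p y] by (simp add: \<delta>_def y_def)
qed

text \<open>Otherwise each point of \<open>S\<close> has an isolating radius, and for uncountably
  many it exceeds one fixed \<open>1/(k+1)\<close>. These points are uniformly separated, against
  sequential compactness.\<close>

lemma uncountable_imp_condensation_point:
  assumes "S \<subseteq> topspace X" "uncountable S"
  shows "\<exists>p\<in>S. \<exists>x. (\<forall>n. x n \<in> S - {p}) \<and> limitin X x p sequentially"
proof -
  have "\<exists>p\<in>S. \<forall>e>0. \<exists>y\<in>S - {p}. d y p < e"
  proof (rule ccontr)
    assume "\<not> ?thesis"
    then obtain e where e: "\<And>p. p \<in> S \<Longrightarrow> e p > 0" "\<And>p y. p \<in> S \<Longrightarrow> y \<in> S - {p} \<Longrightarrow> e p \<le> d y p"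
      by (metis not_le)
    have "S = (\<Union>k. {p \<in> S. inverse (real (Suc k)) < e p})"
      using e(1) reals_Archimedean by blast
    then have "\<not> (\<forall>k. countable {p \<in> S. inverse (real (Suc k)) < e p})"
      using assms(2) countable_UN[of UNIV "\<lambda>k. {p \<in> S. inverse (real (Suc k)) < e p}"] by auto
    then obtain k where "uncountable {p \<in> S. inverse (real (Suc k)) < e p}" (is "uncountable ?T")
      by blast
    then obtain x where x: "inj (x :: nat \<Rightarrow> 'm)" "range x \<subseteq> ?T"
      by (meson infinite_countable_subset uncountable_infinite)
    then have xt: "x n \<in> topspace X" for n
      using assms(1) by blast
    obtain l r where r: "strict_mono (r :: nat \<Rightarrow> nat)" and l: "limitin X (x \<circ> r) l sequentially"
      by (rule convergent_subsequence[of x, OF xt])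
    define c where "c = inverse (real (Suc k))"
    have "c / 2 > 0"
      by (simp add: c_def)
    then have "\<forall>\<^sub>F n in sequentially. (x \<circ> r) n \<in> topspace X \<and> d ((x \<circ> r) n) l < c / 2"
      using l unfolding limitin_dist_iff by blast
    then obtain n where n: "\<And>m. m \<ge> n \<Longrightarrow> x (r m) \<in> topspace X \<and> d (x (r m)) l < c / 2"
      unfolding eventually_sequentially by auto
    have lt: "l \<in> topspace X"
      using l by (rule limitin_topspace)
    have "x (r n) \<noteq> x (r (Suc n))"
      using x(1) r by (metis injD n_not_Suc_n strict_mono_eq)
    moreover have xr: "x (r n) \<in> ?T" "x (r (Suc n)) \<in> ?T"
      using x(2) by auto
    ultimately have "c < d (x (r (Suc n))) (x (r n))"
      using e(2)[of "x (r n)" "x (r (Suc n))"] by (simp add: c_def)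
    then show False
      using n[of n] n[of "Suc n"] triangle[of "x (r (Suc n))" l "x (r n)"] lt commute[of l "x (r n)"]
      by simp
  qed
  then obtain p where p: "p \<in> S" "\<And>e. e > 0 \<Longrightarrow> \<exists>y\<in>S - {p}. d y p < e"
    by blast
  have "\<forall>n. \<exists>y. y \<in> S - {p} \<and> d y p < inverse (real (Suc n))"
    using p(2) by (meson inverse_positive_iff_positive of_nat_0_less_iff zero_less_Suc)
  then obtain x where x: "\<And>n. x n \<in> S - {p}" "\<And>n. d (x n) p < inverse (real (Suc n))"
    by metis
  have "limitin X x p sequentially"
    unfolding limitin_dist_iff
  proof (intro conjI allI impI)
    show "p \<in> topspace X"
      using p assms(1) by blast
    fix e :: real
    assume "e > 0"
    with LIMSEQ_inverse_real_of_nat have "\<forall>\<^sub>F n in sequentially. inverse (real (Suc n)) < e"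
      by (rule order_tendstoD)
    then show "\<forall>\<^sub>F n in sequentially. x n \<in> topspace X \<and> d (x n) p < e"
    proof eventually_elim
      case (elim n)
      then show ?case
        using x[of n] assms(1) by force
    qed
  qed
  then show ?thesis
    using p(1) x(1) by metis
qed

text \<open>The compact set \<open>K\<close> misses a ball around \<open>p\<close>, and each limit
  point other than \<open>p\<close> can be moved back into \<open>K\<close>. Unlike
  \<open>K\<close>, the radius can be compared between different parabolic points.\<close>

lemma bounded_parabolic_gap:
  assumes "bounded_parabolic_point G X \<phi> p"
  shows "\<exists>r>0. \<forall>x\<in>\<Lambda> - {p}. \<exists>h\<in>stabilizer G \<phi> p. r \<le> d p (\<phi> h x)"
proof -
  have p: "p \<in> topspace X"
    using assms unfolding bounded_parabolic_point_def parabolic_point_def by blast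
  obtain K where K: "compactin X K" "K \<subseteq> \<Lambda> - {p}" "(\<Union>h\<in>stabilizer G \<phi> p. \<phi> h ` K) = \<Lambda> - {p}"
    using assms unfolding bounded_parabolic_point_def acts_cocompactly_on_def by blast
  have "closedin X K"
    using K(1) Hausdorff compactin_imp_closedin by blast
  then have "openin X (topspace X - K)"
    by blast
  moreover have "p \<in> topspace X - K"
    using p K(2) by blast
  ultimately obtain r where r: "r > 0" "mball p r \<subseteq> topspace X - K"
    using openin_mtopology[unfolded mtopology_eq, of "topspace X - K"] by blast
  have "\<exists>h\<in>stabilizer G \<phi> p. r \<le> d p (\<phi> h x)" if x: "x \<in> \<Lambda> - {p}" for x
  proof -
    obtain h k where h: "h \<in> stabilizer G \<phi> p" "k \<in> K" "x = \<phi> h k"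
      using x unfolding K(3)[symmetric] by (elim UN_E imageE)
    have kt: "k \<in> topspace X"
      using compactin_subset_topspace[OF K(1)] h(2) by auto
    have "inv\<^bsub>G\<^esub> h \<in> stabilizer G \<phi> p"
      using stabilizer_m_inv_closed[OF p h(1)] .
    moreover have "\<phi> (inv\<^bsub>G\<^esub> h) x = k"
      using h kt stabilizerD(1) by simp
    moreover have "r \<le> d p k"
      using r(2) h(2) kt p by (metis DiffD2 in_mball not_le subsetD)
    ultimately show ?thesis
      by metis
  qed
  then show ?thesis
    using r(1) by blast
qed

lemma geometrically_finite_imp_countable:
  assumes "geometrically_finite G X \<phi>"
  shows "countable {\<xi> \<in> \<Lambda>. \<not> conical \<xi>}"
proof (rule ccontr)
  let ?N = "{\<xi> \<in> \<Lambda>. \<not> conical \<xi>}"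
  \<comment> \<open>Stratification by the size of the gap: countably many strata cover
    \<open>?N\<close>, so an uncountable one supplies points with a common gap.\<close>
  define S where "S k = {p \<in> ?N. \<forall>x\<in>\<Lambda> - {p}. \<exists>h\<in>stabilizer G \<phi> p. inverse (real (Suc k)) < d p (\<phi> h x)}" for k
  assume unc: "uncountable ?N"
  have bdd: "bounded_parabolic_point G X \<phi> p" if "p \<in> ?N" for p
    using that assms unfolding geometrically_finite_def by blast
  have "p \<in> (\<Union>k. S k)" if p: "p \<in> ?N" for p
  proof -
    obtain r where r: "r > 0" "\<forall>x\<in>\<Lambda> - {p}. \<exists>h\<in>stabilizer G \<phi> p. r \<le> d p (\<phi> h x)"
      using bounded_parabolic_gap[OF bdd[OF p]] by blast
    then obtain k where "inverse (real (Suc k)) < r"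
      using reals_Archimedean by blast
    then have "p \<in> S k"
      unfolding S_def using p r(2) by (auto intro: less_le_trans)
    then show ?thesis
      by blast
  qed
  then have sub: "?N \<subseteq> (\<Union>k. S k)"
    by blast
  have "\<not> (\<forall>k. countable (S k))"
  proof
    assume "\<forall>k. countable (S k)"
    then have "countable (\<Union>k. S k)"
      by (intro countable_UN) auto
    then show False
      using countable_subset[OF sub] unc by blast
  qed
  then obtain k where "uncountable (S k)"
    by blast
  define r where "r = inverse (real (Suc k))"
  have St: "S k \<subseteq> topspace X"
    using limit_points_subset by (auto simp: S_def)
  obtain p x where p: "p \<in> S k" and x: "\<And>n. x n \<in> S k - {p}" "limitin X x p sequentially"
    using uncountable_imp_condensation_point[OF St \<open>uncountable (S k)\<close>] by metis
  have pL: "p \<in> \<Lambda>" "\<not> conical p" "p \<in> topspace X"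
    using p limit_points_subset by (auto simp: S_def)
  have xt: "x n \<in> topspace X" for n
    using x(1)[of n] limit_points_subset by (auto simp: S_def)
  have "\<exists>h\<in>stabilizer G \<phi> (x n). r < d (x n) (\<phi> h p)" for n
  proof -
    have "p \<in> \<Lambda> - {x n}"
      using pL x(1)[of n] by auto
    then show ?thesis
      using x(1)[of n] unfolding S_def r_def by blast
  qed
  then obtain h where h: "\<And>n. h n \<in> stabilizer G \<phi> (x n)" "\<And>n. r < d (x n) (\<phi> (h n) p)"
    by metis
  have hG: "h n \<in> carrier G" and hx: "\<phi> (h n) (x n) = x n" for n
    using stabilizerD[OF h(1)[of n]] by auto
  have r0: "r > 0"
    by (simp add: r_def)
  \<comment> \<open>\<open>x n\<close> tends to \<open>p\<close>, while
    \<open>\<phi> (h n) p\<close> stays more than \<open>r\<close> away from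
    \<open>x n\<close>.\<close>
  have apart: "l' \<noteq> p" if "strict_mono (q :: nat \<Rightarrow> nat)" "limitin X (\<lambda>n. \<phi> (h (q n)) p) l' sequentially" for q l'
  proof
    assume "l' = p"
    have r2: "r / 2 > 0"
      using r0 by simp
    have "limitin X (x \<circ> q) p sequentially"
      using limitin_subsequence[OF that(1) x(2)] .
    then have "\<forall>\<^sub>F n in sequentially. (x \<circ> q) n \<in> topspace X \<and> d ((x \<circ> q) n) p < r / 2"
      unfolding limitin_dist_iff using r2 by blast
    moreover have "\<forall>\<^sub>F n in sequentially. \<phi> (h (q n)) p \<in> topspace X \<and> d (\<phi> (h (q n)) p) p < r / 2"
      using that(2) r2 unfolding limitin_dist_iff \<open>l' = p\<close> by blast
    ultimately have "\<forall>\<^sub>F n in sequentially. False"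
    proof eventually_elim
      case (elim n)
      then show ?case
        using h(2)[of "q n"] triangle[of "x (q n)" p "\<phi> (h (q n)) p"] pL(3) commute[of p "\<phi> (h (q n)) p"]
        by simp
    qed
    then show False
      by simp
  qed
  \<comment> \<open>An element recurring infinitely often would fix points tending to
    \<open>p\<close>, hence \<open>p\<close> itself, against \<open>apart\<close>.\<close>
  have fin: "finite {n. h n = g}" for g
  proof (rule ccontr)
    assume "infinite {n. h n = g}"
    then obtain q where q: "strict_mono (q :: nat \<Rightarrow> nat)" "\<And>n. h (q n) = g"
      using infinite_enumerate by blast
    have limp: "limitin X (x \<circ> q) p sequentially"
      using limitin_subsequence[OF q(1) x(2)] .
    moreover have "g \<in> carrier G"
      using hG[of "q 0"] q(2)[of 0] by simp
    ultimately have "limitin X (\<lambda>n. \<phi> g ((x \<circ> q) n)) (\<phi> g p) sequentially"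
      by (intro act_limit)
    moreover have "(\<lambda>n. \<phi> g ((x \<circ> q) n)) = x \<circ> q"
    proof
      fix n
      show "\<phi> g ((x \<circ> q) n) = (x \<circ> q) n"
        using hx[of "q n"] q(2)[of n] by simp
    qed
    ultimately have "limitin X (x \<circ> q) (\<phi> g p) sequentially"
      by simp
    then have "\<phi> g p = p"
      using limp by (rule limit_unique)
    then have "limitin X (\<lambda>n. \<phi> (h (q n)) p) p sequentially"
      using q(2) pL(3) by simp
    then show False
      using apart[OF q(1), of p] by simp
  qed
  obtain q1 a b where q1: "strict_mono (q1 :: nat \<Rightarrow> nat)" and c1: "conv (h \<circ> q1) a b"
    by (rule exists_conv_subsequence[of h, OF hG fin])
  obtain q2 c where q2: "strict_mono (q2 :: nat \<Rightarrow> nat)"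
    and l2: "limitin X ((\<lambda>n. \<phi> (h (q1 n)) p) \<circ> q2) c sequentially"
    by (rule convergent_subsequence[of "\<lambda>n. \<phi> (h (q1 n)) p"]) (use hG pL in auto)
  define q where "q = q1 \<circ> q2"
  have q: "strict_mono q"
    using q1 q2 by (simp add: q_def strict_mono_o)
  have conv: "conv (h \<circ> q) a b"
    using conv_subsequence[OF c1 q2] by (simp add: q_def o_assoc)
  have lc: "limitin X (\<lambda>n. \<phi> (h (q n)) p) c sequentially"
    using l2 by (simp add: q_def o_def)
  have xq: "limitin X (x \<circ> q) p sequentially"
    using limitin_subsequence[OF q x(2)] .
  have "c \<noteq> p"
    using apart[OF q lc] .
  \<comment> \<open>Otherwise both \<open>p\<close> and the points \<open>x (q n)\<close>, which
    converge to \<open>p\<close>, are carried to \<open>b\<close>. As \<open>h (q n)\<close> fixes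
    \<open>x (q n)\<close>, this gives \<open>c = b = p\<close>.\<close>
  have "a = p"
  proof (rule ccontr)
    assume "a \<noteq> p"
    then have "limitin X (\<lambda>n. \<phi> (h (q n)) p) b sequentially"
      using conv_limit_const[OF conv pL(3)] by simp
    then have "c = b"
      by (rule limit_unique[OF lc])
    have "limitin X (\<lambda>n. \<phi> (h (q n)) (x (q n))) b sequentially"
      using conv_limit[OF conv xq] \<open>a \<noteq> p\<close> by simp
    then have "limitin X (x \<circ> q) b sequentially"
      using hx by (simp add: o_def)
    then show False
      using limit_unique[OF xq, of b] \<open>c = b\<close> \<open>c \<noteq> p\<close> by simp
  qed
  \<comment> \<open>Otherwise \<open>h (q n)\<close> eventually contracts off the
    \<open>e\<close>-ball around \<open>p\<close>, against \<open>parabolic_not_contracting\<close>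
    with \<open>a\<close> taken as \<open>p\<close> and the parabolic point as
    \<open>x (q n)\<close>.\<close>
  have "b = p"
  proof (rule ccontr)
    assume "b \<noteq> p"
    have bt: "b \<in> topspace X"
      using conv conv_topspace by blast
    obtain z where z: "z \<in> topspace X" "z \<noteq> p" "z \<noteq> b"
      by (rule exists_third_point)
    define e where "e = min (d p b / 2) (min (d p z) (d b z))"
    have e: "e > 0" "2 * e \<le> d p b" "e \<le> d p z" "e \<le> d b z"
      using z \<open>b \<noteq> p\<close> bt pL(3) by (auto simp: e_def)
    have "\<forall>\<^sub>F n in sequentially. \<forall>y\<in>topspace X. e \<le> d p y \<longrightarrow> d b (\<phi> ((h \<circ> q) n) y) < e"
      using conv e(1) unfolding conv_def \<open>a = p\<close> by blast
    moreover have "\<forall>\<^sub>F n in sequentially. (x \<circ> q) n \<in> topspace X \<and> d ((x \<circ> q) n) p < e"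
      using xq e(1) unfolding limitin_dist_iff by blast
    ultimately have "\<forall>\<^sub>F n in sequentially. False"
    proof eventually_elim
      case (elim n)
      have "parabolic_point G X \<phi> (x (q n))"
        using bdd[of "x (q n)"] x(1)[of "q n"] unfolding S_def bounded_parabolic_point_def by blast
      then have "\<exists>y\<in>topspace X. e \<le> d p y \<and> e \<le> d b (\<phi> (h (q n)) y)"
        using parabolic_not_contracting[OF _ h(1)[of "q n"] pL(3) bt z(1) e(2-4)] elim(2)
        by (simp add: commute)
      then show ?case
        using elim(1) by force
    qed
    then show False
      by simp
  qed
  then show False
    using not_conicalD[OF pL(2), of "h \<circ> q" b c] conv \<open>a = p\<close> lc \<open>c \<noteq> p\<close> by simp
qed

subsection \<open>Non-conical points that are not bounded parabolic\<close>

lemma act_continuous_at: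
  assumes "h \<in> carrier G" "b \<in> topspace X" "e > 0"
  shows "\<exists>s>0. \<forall>y\<in>topspace X. d b y < s \<longrightarrow> d (\<phi> h b) (\<phi> h y) < e"
proof -
  have "openin X {y \<in> topspace X. \<phi> h y \<in> mball (\<phi> h b) e}"
    using homeomorphic_imp_continuous_map[OF homeomorphic[OF assms(1)]] openin_mball[of "\<phi> h b" e]
    unfolding mtopology_eq by (rule openin_continuous_map_preimage)
  moreover have "b \<in> {y \<in> topspace X. \<phi> h y \<in> mball (\<phi> h b) e}"
    using assms by simp
  ultimately obtain s where s: "s > 0" "mball b s \<subseteq> {y \<in> topspace X. \<phi> h y \<in> mball (\<phi> h b) e}"
    using openin_mtopology[unfolded mtopology_eq, of "{y \<in> topspace X. \<phi> h y \<in> mball (\<phi> h b) e}"]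
    by blast
  have "d (\<phi> h b) (\<phi> h y) < e" if "y \<in> topspace X" "d b y < s" for y
  proof -
    have "y \<in> mball b s"
      using that assms(2) by simp
    then show ?thesis
      using s(2) by auto
  qed
  then show ?thesis
    using s(1) by blast
qed

lemma conv_compose_left:
  assumes "conv g a b" "h \<in> carrier G"
  shows "conv (\<lambda>n. h \<otimes>\<^bsub>G\<^esub> g n) a (\<phi> h b)"
  unfolding conv_def
proof (intro conjI allI impI)
  have g: "g n \<in> carrier G" for n
    using conv_carrier assms(1) .
  show "range (\<lambda>n. h \<otimes>\<^bsub>G\<^esub> g n) \<subseteq> carrier G"
    using g assms(2) by auto
  show "a \<in> topspace X" "\<phi> h b \<in> topspace X"
    using assms conv_topspace[OF assms(1)] by auto
  fix r :: real
  assume "r > 0"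
  then obtain s where s: "s > 0" "\<forall>y\<in>topspace X. d b y < s \<longrightarrow> d (\<phi> h b) (\<phi> h y) < r"
    using act_continuous_at[OF assms(2) conv_topspace(2)[OF assms(1)]] by blast
  define t where "t = min r s"
  have "t > 0"
    using \<open>r > 0\<close> s by (simp add: t_def)
  then have "\<forall>\<^sub>F n in sequentially. \<forall>x\<in>topspace X. t \<le> d a x \<longrightarrow> d b (\<phi> (g n) x) < t"
    using assms(1) unfolding conv_def by blast
  then show "\<forall>\<^sub>F n in sequentially. \<forall>x\<in>topspace X. r \<le> d a x \<longrightarrow> d (\<phi> h b) (\<phi> (h \<otimes>\<^bsub>G\<^esub> g n) x) < r"
  proof eventually_elim
    case (elim n)
    show ?case
    proof (intro ballI impI)
      fix x
      assume x: "x \<in> topspace X" "r \<le> d a x"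
      then have "t \<le> d a x"
        by (simp add: t_def)
      then have "d b (\<phi> (g n) x) < s"
        using elim x(1) by (force simp: t_def)
      then show "d (\<phi> h b) (\<phi> (h \<otimes>\<^bsub>G\<^esub> g n) x) < r"
        using s(2) x(1) g composition_rule[OF x(1) assms(2) g] by simp
    qed
  qed
qed

text \<open>Inversion turns right composition into left composition and swaps repelling and
  attracting points.\<close>

lemma conv_compose_right:
  assumes "conv g (\<phi> h a) b" "h \<in> carrier G" "a \<in> topspace X"
  shows "conv (\<lambda>n. g n \<otimes>\<^bsub>G\<^esub> h) a b"
proof -
  have g: "g n \<in> carrier G" for n
    using conv_carrier assms(1) .
  have "conv (\<lambda>n. inv\<^bsub>G\<^esub> h \<otimes>\<^bsub>G\<^esub> inv\<^bsub>G\<^esub> (g n)) b a"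
    using conv_compose_left[OF conv_inv[OF assms(1)], of "inv\<^bsub>G\<^esub> h"] assms by simp
  then have "conv (\<lambda>n. inv\<^bsub>G\<^esub> (inv\<^bsub>G\<^esub> h \<otimes>\<^bsub>G\<^esub> inv\<^bsub>G\<^esub> (g n))) a b"
    by (rule conv_inv)
  then show ?thesis
    using g assms(2) by (simp add: inv_mult_group)
qed

lemma act_limit_points:
  assumes "h \<in> carrier G" "b \<in> \<Lambda>"
  shows "\<phi> h b \<in> \<Lambda>"
  using assms conv_compose_left unfolding limit_points_iff by blast

lemma not_conical_act:
  assumes "h \<in> carrier G" "\<xi> \<in> topspace X" "\<not> conical \<xi>"
  shows "\<not> conical (\<phi> h \<xi>)"
proof
  assume "conical (\<phi> h \<xi>)"
  then obtain g b c where g: "conv g (\<phi> h \<xi>) b"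
    and lim: "limitin X (\<lambda>n. \<phi> (g n) (\<phi> h \<xi>)) c sequentially" and "c \<noteq> b"
    unfolding conical_point_def by (auto simp: convergence_sequence_iff)
  have "\<phi> (g n \<otimes>\<^bsub>G\<^esub> h) \<xi> = \<phi> (g n) (\<phi> h \<xi>)" for n
    using composition_rule[OF assms(2) conv_carrier[OF g] assms(1)] .
  then show False
    using not_conicalD[OF assms(3) conv_compose_right[OF g assms(1,2)], of c] lim \<open>c \<noteq> b\<close> by simp
qed

lemma inverse_eventually_less:
  assumes "strict_mono (r :: nat \<Rightarrow> nat)" "(e :: real) > 0"
  shows "\<forall>\<^sub>F n in sequentially. inverse (real (Suc (r n))) < e"
  using eventually_subseq[OF assms(1) order_tendstoD(2)[OF LIMSEQ_inverse_real_of_nat assms(2)]] .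

text \<open>A diagonal choice: from a sequence attracted by \<open>b k\<close> take one element
  accurate up to \<open>1/(k+1)\<close>, then a subsequence along which the repelling points
  converge.\<close>

lemma limit_points_closed:
  assumes b: "\<And>k. b k \<in> \<Lambda>" and lim: "limitin X b l sequentially"
  shows "l \<in> \<Lambda>"
proof -
  have "\<exists>g a. g \<in> carrier G \<and> a \<in> topspace X \<and> (\<forall>x\<in>topspace X.
      inverse (real (Suc k)) \<le> d a x \<longrightarrow> d (b k) (\<phi> g x) < inverse (real (Suc k)))" for k
  proof -
    obtain g a where g: "conv g a (b k)"
      using b[of k] unfolding limit_points_iff by blast
    have "inverse (real (Suc k)) > 0"
      by simp
    then have "\<forall>\<^sub>F n in sequentially. \<forall>x\<in>topspace X.
        inverse (real (Suc k)) \<le> d a x \<longrightarrow> d (b k) (\<phi> (g n) x) < inverse (real (Suc k))"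
      using g unfolding conv_def by blast
    then obtain n where "\<forall>x\<in>topspace X.
        inverse (real (Suc k)) \<le> d a x \<longrightarrow> d (b k) (\<phi> (g n) x) < inverse (real (Suc k))"
      unfolding eventually_sequentially by blast
    then show ?thesis
      using conv_carrier[OF g] conv_topspace[OF g] by blast
  qed
  then obtain g a where g: "\<And>k. g k \<in> carrier G" and a: "\<And>k. a k \<in> topspace X"
    and ga: "\<And>k x. x \<in> topspace X \<Longrightarrow> inverse (real (Suc k)) \<le> d (a k) x \<Longrightarrow>
      d (b k) (\<phi> (g k) x) < inverse (real (Suc k))"
    by metis
  obtain q a' where q: "strict_mono (q :: nat \<Rightarrow> nat)" and a': "limitin X (a \<circ> q) a' sequentially"
    by (rule convergent_subsequence[of a, OF a])
  have lt: "l \<in> topspace X" and at: "a' \<in> topspace X" and bt: "b k \<in> topspace X" for k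
    using limitin_topspace[OF lim] limitin_topspace[OF a'] b limit_points_subset by auto
  have "conv (g \<circ> q) a' l"
    unfolding conv_def
  proof (intro conjI allI impI)
    show "range (g \<circ> q) \<subseteq> carrier G" "a' \<in> topspace X" "l \<in> topspace X"
      using g lt at by auto
    fix r :: real
    assume "r > 0"
    then have r2: "r / 2 > 0"
      by simp
    have "limitin X (b \<circ> q) l sequentially"
      using limitin_subsequence[OF q lim] .
    then have "\<forall>\<^sub>F n in sequentially. (b \<circ> q) n \<in> topspace X \<and> d ((b \<circ> q) n) l < r / 2"
      unfolding limitin_dist_iff using r2 by blast
    moreover have "\<forall>\<^sub>F n in sequentially. (a \<circ> q) n \<in> topspace X \<and> d ((a \<circ> q) n) a' < r / 2"
      using a' r2 unfolding limitin_dist_iff by blast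
    moreover have "\<forall>\<^sub>F n in sequentially. inverse (real (Suc (q n))) < r / 2"
      by (rule inverse_eventually_less[OF q r2])
    ultimately show "\<forall>\<^sub>F n in sequentially. \<forall>x\<in>topspace X. r \<le> d a' x \<longrightarrow> d l (\<phi> ((g \<circ> q) n) x) < r"
    proof eventually_elim
      case (elim n)
      show ?case
      proof (intro ballI impI)
        fix x
        assume x: "x \<in> topspace X" "r \<le> d a' x"
        have "d a' x \<le> d a' (a (q n)) + d (a (q n)) x"
          using triangle at a x by blast
        then have "inverse (real (Suc (q n))) \<le> d (a (q n)) x"
          using elim x commute[of a' "a (q n)"] by simp
        then have "d (b (q n)) (\<phi> (g (q n)) x) < inverse (real (Suc (q n)))"
          using ga x by blast
        moreover have "d l (\<phi> (g (q n)) x) \<le> d l (b (q n)) + d (b (q n)) (\<phi> (g (q n)) x)"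
          using triangle lt bt g x act_closed by blast
        ultimately show "d l (\<phi> ((g \<circ> q) n) x) < r"
          using elim commute[of l "b (q n)"] by simp
      qed
    qed
  qed
  then show ?thesis
    unfolding limit_points_iff by blast
qed

lemma closedin_limit_points: "closedin X \<Lambda>"
  using metric_closedin_iff_sequentially_closed[unfolded mtopology_eq, of \<Lambda>]
    limit_points_subset limit_points_closed by (metis rangeI subsetD)

text \<open>Infinitely many such elements contain a convergence sequence. Its repelling point
  differs from one of \<xi> and \<eta>, which is then carried to \<open>b\<close>. So is the other:
  directly if it is not the repelling point, by non-conicality (along a subsequence) if it is. The
  images thus come together.\<close>

lemma finite_far_pairs:
  assumes "\<xi> \<in> topspace X" "\<eta> \<in> topspace X" "\<xi> \<noteq> \<eta>" "\<not> conical \<xi>" "\<not> conical \<eta>" "e > 0"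
  shows "finite {g \<in> carrier G. e \<le> d (\<phi> g \<xi>) (\<phi> g \<eta>)}" (is "finite ?A")
proof (rule ccontr)
  assume "infinite ?A"
  then obtain s where s: "inj (s :: nat \<Rightarrow> 'g)" "range s \<subseteq> ?A"
    using infinite_countable_subset by blast
  have sG: "s n \<in> carrier G" and far: "e \<le> d (\<phi> (s n) \<xi>) (\<phi> (s n) \<eta>)" for n
    using s(2) by auto
  have fin: "finite {n. s n = g}" for g
    using finite_vimageI[of "{g}" s] s(1) by (simp add: vimage_def)
  obtain q1 a b where q1: "strict_mono (q1 :: nat \<Rightarrow> nat)" and c1: "conv (s \<circ> q1) a b"
    by (rule exists_conv_subsequence[of s, OF sG fin])
  have notboth: False if "strict_mono q" "limitin X (\<lambda>n. \<phi> (s (q n)) \<xi>) l sequentially"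
    "limitin X (\<lambda>n. \<phi> (s (q n)) \<eta>) l sequentially" for q l
  proof -
    have e2: "e / 2 > 0"
      using assms by simp
    have "\<forall>\<^sub>F n in sequentially. \<phi> (s (q n)) \<xi> \<in> topspace X \<and> d (\<phi> (s (q n)) \<xi>) l < e / 2"
      using that(2) e2 unfolding limitin_dist_iff by blast
    moreover have "\<forall>\<^sub>F n in sequentially. \<phi> (s (q n)) \<eta> \<in> topspace X \<and> d (\<phi> (s (q n)) \<eta>) l < e / 2"
      using that(3) e2 unfolding limitin_dist_iff by blast
    ultimately have "\<forall>\<^sub>F n in sequentially. False"
    proof eventually_elim
      case (elim n)
      then show ?case
        using far[of "q n"] triangle[of "\<phi> (s (q n)) \<xi>" l "\<phi> (s (q n)) \<eta>"]
          limitin_topspace[OF that(2)] commute[of l "\<phi> (s (q n)) \<eta>"] by simp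
    qed
    then show False
      by simp
  qed
  have repelling: False if xy: "x \<in> {\<xi>, \<eta>}" "y \<in> {\<xi>, \<eta>}" "x \<noteq> y" "a \<noteq> y" for x y
  proof -
    have t: "x \<in> topspace X" "y \<in> topspace X" "\<not> conical x"
      using xy assms by auto
    have ly: "limitin X (\<lambda>n. \<phi> ((s \<circ> q1) n) y) b sequentially"
      using conv_limit_const[OF c1 t(2)] xy by blast
    obtain q2 c where q2: "strict_mono (q2 :: nat \<Rightarrow> nat)"
      and lx: "limitin X ((\<lambda>n. \<phi> ((s \<circ> q1) n) x) \<circ> q2) c sequentially"
      by (rule convergent_subsequence[of "\<lambda>n. \<phi> ((s \<circ> q1) n) x"]) (use sG t in auto)
    have c2: "conv ((s \<circ> q1) \<circ> q2) a b"
      using conv_subsequence[OF c1 q2] .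
    have "c = b"
    proof (cases "a = x")
      case True
      then show ?thesis
        using not_conicalD[OF t(3)] c2 lx by (simp add: o_def)
    next
      case False
      then show ?thesis
        using limit_unique[OF lx] conv_limit_const[OF c2 t(1)] by (simp add: o_def)
    qed
    moreover have "limitin X ((\<lambda>n. \<phi> ((s \<circ> q1) n) y) \<circ> q2) b sequentially"
      using limitin_subsequence[OF q2 ly] .
    moreover have "strict_mono (q1 \<circ> q2)"
      using q1 q2 by (simp add: strict_mono_o)
    ultimately show False
      using notboth[of "q1 \<circ> q2" b] lx xy by (auto simp: o_def)
  qed
  show False
    using repelling[of \<xi> \<eta>] repelling[of \<eta> \<xi>] assms(3) by auto
qed

text \<open>If \<open>a\<close> is not \<xi>, the fixed point \<xi> is carried to \<open>b\<close>;
  if it is, non-conicality says the same of the constant sequence \<xi>.\<close>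

lemma stabilizer_attractor:
  assumes "\<xi> \<in> topspace X" "\<not> conical \<xi>" "conv g a b" "\<And>n. g n \<in> stabilizer G \<phi> \<xi>"
  shows "b = \<xi>"
proof -
  have "(\<lambda>n. \<phi> (g n) \<xi>) = (\<lambda>n. \<xi>)"
    using stabilizerD(2)[OF assms(4)] by blast
  then have lim: "limitin X (\<lambda>n. \<phi> (g n) \<xi>) \<xi> sequentially"
    using assms(1) by simp
  show ?thesis
  proof (cases "a = \<xi>")
    case True
    then show ?thesis
      using not_conicalD[OF assms(2) _ lim] assms(3) by blast
  next
    case False
    then show ?thesis
      using limit_unique[OF lim conv_limit_const[OF assms(3,1)]] by simp
  qed
qed

lemma stabilizer_repeller:
  assumes "\<xi> \<in> topspace X" "\<not> conical \<xi>" "conv g a b" "\<And>n. g n \<in> stabilizer G \<phi> \<xi>"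
  shows "a = \<xi>"
  using stabilizer_attractor[OF assms(1,2) conv_inv[OF assms(3)]]
    stabilizer_m_inv_closed[OF assms(1) assms(4)] by blast

text \<open>A sequence attracted by \<open>x\<close> carries any orbit point off its repelling point
  \<open>a\<close> towards \<open>x\<close>. Without such an orbit point the whole group fixes
  \<xi>, and \<open>stabilizer_attractor\<close> gives \<open>x = \<xi>\<close>. Distances below
  \<open>d \<xi> x\<close> keep the approximating point off \<xi>.\<close>

lemma orbit_dense_aux:
  assumes x: "x \<in> \<Lambda>" "x \<noteq> \<xi>" and \<xi>: "\<xi> \<in> topspace X" "\<not> conical \<xi>" and "e > 0"
  shows "\<exists>\<eta>\<in>orbit G \<phi> \<xi> - {\<xi>}. d \<eta> x < e"
proof -
  obtain g a where g: "conv g a x"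
    using x unfolding limit_points_iff by blast
  have "\<exists>u\<in>orbit G \<phi> \<xi>. u \<noteq> a"
  proof (rule ccontr)
    assume neg: "\<not> ?thesis"
    then have "a = \<xi>"
      using orbit_refl[OF \<xi>(1)] by auto
    then have "\<phi> (g n) \<xi> = \<xi>" for n
      using neg conv_carrier[OF g] unfolding orbit_def by blast
    then have "g n \<in> stabilizer G \<phi> \<xi>" for n
      using conv_carrier[OF g] unfolding stabilizer_def by blast
    then show False
      using stabilizer_attractor[OF \<xi> g] x(2) by blast
  qed
  then obtain h where h: "h \<in> carrier G" "\<phi> h \<xi> \<noteq> a"
    unfolding orbit_def by blast
  have xt: "x \<in> topspace X"
    using x limit_points_subset by blast
  have "limitin X (\<lambda>n. \<phi> (g n) (\<phi> h \<xi>)) x sequentially"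
    using conv_limit_const[OF g _ h(2)] h(1) \<xi>(1) by simp
  moreover have "min e (d \<xi> x) > 0"
    using \<open>e > 0\<close> x xt \<xi> by auto
  ultimately have "\<forall>\<^sub>F n in sequentially. \<phi> (g n) (\<phi> h \<xi>) \<in> topspace X \<and> d (\<phi> (g n) (\<phi> h \<xi>)) x < min e (d \<xi> x)"
    unfolding limitin_dist_iff by blast
  then obtain n where n: "d (\<phi> (g n) (\<phi> h \<xi>)) x < min e (d \<xi> x)"
    unfolding eventually_sequentially by blast
  moreover have "\<phi> (g n) (\<phi> h \<xi>) = \<phi> (g n \<otimes>\<^bsub>G\<^esub> h) \<xi>"
    using composition_rule[OF \<xi>(1) conv_carrier[OF g] h(1)] by simp
  then have "\<phi> (g n) (\<phi> h \<xi>) \<in> orbit G \<phi> \<xi>"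
    unfolding orbit_def using conv_carrier[OF g] h(1) by blast
  moreover have "\<phi> (g n) (\<phi> h \<xi>) \<noteq> \<xi>"
    using n by auto
  ultimately show ?thesis
    by force
qed

lemma orbit_act:
  assumes "g \<in> carrier G" "\<xi> \<in> topspace X" "\<eta> \<in> orbit G \<phi> \<xi>"
  shows "\<phi> g \<eta> \<in> orbit G \<phi> \<xi>"
proof -
  obtain h where h: "h \<in> carrier G" "\<eta> = \<phi> h \<xi>"
    using assms(3) unfolding orbit_def by blast
  then have "\<phi> g \<eta> = \<phi> (g \<otimes>\<^bsub>G\<^esub> h) \<xi>"
    using composition_rule assms by simp
  then show ?thesis
    unfolding orbit_def using h assms(1) by blast
qed

lemma orbit_subset_topspace: "\<xi> \<in> topspace X \<Longrightarrow> orbit G \<phi> \<xi> \<subseteq> topspace X"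
  unfolding orbit_def by auto

text \<open>For \<open>x = \<xi>\<close> the approximating point might be \<xi> itself. Of three
  distinct orbit points two avoid the repelling point; their images are distinct, so one of them is
  not \<xi>.\<close>

lemma orbit_dense:
  assumes x: "x \<in> \<Lambda>" and \<xi>: "\<xi> \<in> topspace X" "\<not> conical \<xi>" and "e > 0"
  shows "\<exists>\<eta>\<in>orbit G \<phi> \<xi> - {\<xi>}. d \<eta> x < e"
proof (cases "x = \<xi>")
  case False
  then show ?thesis
    using orbit_dense_aux assms by blast
next
  case True
  obtain x1 where x1: "x1 \<in> \<Lambda>" "x1 \<noteq> \<xi>"
    by (rule exists_third_limit_point[of \<xi> \<xi>])
  obtain x2 where x2: "x2 \<in> \<Lambda>" "x2 \<noteq> \<xi>" "x2 \<noteq> x1"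
    by (rule exists_third_limit_point[of \<xi> x1])
  have xt: "x1 \<in> topspace X" "x2 \<in> topspace X"
    using x1 x2 limit_points_subset by auto
  define e' where "e' = d x1 x2 / 2"
  have "e' > 0"
    using x2 xt by (auto simp: e'_def)
  obtain u1 where u1: "u1 \<in> orbit G \<phi> \<xi> - {\<xi>}" "d u1 x1 < e'"
    using orbit_dense_aux[OF x1 \<xi> \<open>e' > 0\<close>] by blast
  obtain u2 where u2: "u2 \<in> orbit G \<phi> \<xi> - {\<xi>}" "d u2 x2 < e'"
    using orbit_dense_aux[OF x2(1,2) \<xi> \<open>e' > 0\<close>] by blast
  have ut: "u1 \<in> topspace X" "u2 \<in> topspace X"
    using u1 u2 orbit_subset_topspace[OF \<xi>(1)] by auto
  have "u1 \<noteq> u2"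
    using u1 u2 triangle[OF xt(1) ut(1) xt(2)] commute[of x1 u1] by (auto simp: e'_def)
  obtain g a where g: "conv g a x"
    using x unfolding limit_points_iff by blast
  obtain v w where vw: "v \<in> orbit G \<phi> \<xi>" "w \<in> orbit G \<phi> \<xi>" "v \<noteq> w" "v \<noteq> a" "w \<noteq> a"
    using u1 u2 \<open>u1 \<noteq> u2\<close> orbit_refl[OF \<xi>(1)] by (metis DiffD1 DiffD2 singletonI)
  have vt: "v \<in> topspace X" "w \<in> topspace X"
    using vw orbit_subset_topspace[OF \<xi>(1)] by auto
  have "\<forall>\<^sub>F n in sequentially. \<phi> (g n) v \<in> topspace X \<and> d (\<phi> (g n) v) x < e"
    using conv_limit_const[OF g vt(1) vw(4)] \<open>e > 0\<close> unfolding limitin_dist_iff by blast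
  moreover have "\<forall>\<^sub>F n in sequentially. \<phi> (g n) w \<in> topspace X \<and> d (\<phi> (g n) w) x < e"
    using conv_limit_const[OF g vt(2) vw(5)] \<open>e > 0\<close> unfolding limitin_dist_iff by blast
  ultimately have "\<forall>\<^sub>F n in sequentially. d (\<phi> (g n) v) x < e \<and> d (\<phi> (g n) w) x < e"
    by eventually_elim simp
  then obtain n where n: "d (\<phi> (g n) v) x < e" "d (\<phi> (g n) w) x < e"
    unfolding eventually_sequentially by blast
  have gn: "g n \<in> carrier G"
    using conv_carrier[OF g] .
  have "\<phi> (g n) v \<noteq> \<phi> (g n) w"
    using act_eq_iff[OF gn vt] vw(3) by simp
  moreover have "\<phi> (g n) v \<in> orbit G \<phi> \<xi>" "\<phi> (g n) w \<in> orbit G \<phi> \<xi>"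
    using orbit_act[OF gn \<xi>(1)] vw by auto
  ultimately show ?thesis
    using n by (metis DiffI singletonD)
qed

lemma bounded_parabolicI:
  assumes \<xi>: "\<xi> \<in> \<Lambda>" "\<not> conical \<xi>" and "r > 0"
    and escape: "\<And>\<eta>. \<eta> \<in> orbit G \<phi> \<xi> - {\<xi>} \<Longrightarrow> \<exists>h\<in>stabilizer G \<phi> \<xi>. r \<le> d \<xi> (\<phi> h \<eta>)"
  shows "bounded_parabolic_point G X \<phi> \<xi>"
proof -
  have \<xi>t: "\<xi> \<in> topspace X"
    using \<xi> limit_points_subset by blast
  \<comment> \<open>Density extends \<open>escape\<close> from the orbit to all limit points.
    Approximate \<open>x\<close> by orbit points \<open>\<eta> k\<close> with escaping elements
    \<open>h k\<close>. If some element recurs, continuity makes it move \<open>x\<close> away. If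
    none does, a subsequence has \<xi> as repelling and attracting point, which is compatible with
    the escape of \<open>\<eta> k\<close> only for \<open>x = \<xi>\<close>.\<close>
  have key: "(\<exists>h\<in>stabilizer G \<phi> \<xi>. r \<le> d \<xi> (\<phi> h x)) \<or> (x = \<xi> \<and> infinite (stabilizer G \<phi> \<xi>))"
    if x: "x \<in> \<Lambda>" for x
  proof -
    have "\<exists>\<eta> h. \<eta> \<in> orbit G \<phi> \<xi> - {\<xi>} \<and> d \<eta> x < inverse (real (Suc k)) \<and>
        h \<in> stabilizer G \<phi> \<xi> \<and> r \<le> d \<xi> (\<phi> h \<eta>)" for k
    proof -
      have "inverse (real (Suc k)) > 0"
        by simp
      then obtain \<eta> where "\<eta> \<in> orbit G \<phi> \<xi> - {\<xi>}" "d \<eta> x < inverse (real (Suc k))"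
        using orbit_dense[OF x \<xi>t \<xi>(2)] by blast
      then show ?thesis
        using escape by blast
    qed
    then obtain \<eta> h where \<eta>: "\<And>k. \<eta> k \<in> orbit G \<phi> \<xi> - {\<xi>}" "\<And>k. d (\<eta> k) x < inverse (real (Suc k))"
      and h: "\<And>k. h k \<in> stabilizer G \<phi> \<xi>" and far: "\<And>k. r \<le> d \<xi> (\<phi> (h k) (\<eta> k))"
      by metis
    have \<eta>t: "\<eta> k \<in> topspace X" for k
      using \<eta>(1)[of k] orbit_subset_topspace[OF \<xi>t] by blast
    have hG: "h k \<in> carrier G" for k
      using h by (rule stabilizerD)
    have xt: "x \<in> topspace X"
      using x limit_points_subset by blast
    have lim: "limitin X \<eta> x sequentially"
      unfolding limitin_dist_iff
    proof (intro conjI allI impI)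
      fix e :: real
      assume "e > 0"
      then have "\<forall>\<^sub>F n in sequentially. inverse (real (Suc (id n))) < e"
        by (intro inverse_eventually_less) (auto simp: strict_mono_def)
      then show "\<forall>\<^sub>F n in sequentially. \<eta> n \<in> topspace X \<and> d (\<eta> n) x < e"
      proof eventually_elim
        case (elim n)
        then show ?case
          using \<eta>(2)[of n] \<eta>t by simp
      qed
    qed (rule xt)
    have limq: "limitin X (\<eta> \<circ> q) x sequentially" if "strict_mono q" for q :: "nat \<Rightarrow> nat"
      using limitin_subsequence[OF that lim] .
    have far_limit: "r \<le> d \<xi> l" if "strict_mono q" "limitin X (\<lambda>n. \<phi> (h (q n)) (\<eta> (q n))) l sequentially"
      for q :: "nat \<Rightarrow> nat" and l
    proof (rule ccontr)
      assume "\<not> ?thesis"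
      then have "r - d \<xi> l > 0"
        by simp
      then have "\<forall>\<^sub>F n in sequentially. \<phi> (h (q n)) (\<eta> (q n)) \<in> topspace X \<and>
          d (\<phi> (h (q n)) (\<eta> (q n))) l < r - d \<xi> l"
        using that(2) unfolding limitin_dist_iff by blast
      then have "\<forall>\<^sub>F n in sequentially. False"
      proof eventually_elim
        case (elim n)
        then show ?case
          using far[of "q n"] triangle[OF \<xi>t limitin_topspace[OF that(2)], of "\<phi> (h (q n)) (\<eta> (q n))"]
            commute[of l "\<phi> (h (q n)) (\<eta> (q n))"] by simp
      qed
      then show False
        by simp
    qed
    show ?thesis
    proof (cases "\<exists>g. infinite {n. h n = g}")
      case True
      then obtain g where "infinite {n. h n = g}"
        by blast
      then obtain q where q: "strict_mono (q :: nat \<Rightarrow> nat)" "\<And>n. h (q n) = g"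
        using infinite_enumerate by blast
      have g: "g \<in> stabilizer G \<phi> \<xi>" "g \<in> carrier G"
        using h[of "q 0"] hG[of "q 0"] q(2)[of 0] by auto
      have "limitin X (\<lambda>n. \<phi> g ((\<eta> \<circ> q) n)) (\<phi> g x) sequentially"
        using act_limit[OF g(2) limq[OF q(1)]] .
      then have "r \<le> d \<xi> (\<phi> g x)"
        using far_limit[OF q(1)] q(2) by simp
      then show ?thesis
        using g by blast
    next
      case False
      then have fin: "finite {n. h n = g}" for g
        by blast
      obtain q where q: "strict_mono (q :: nat \<Rightarrow> nat)" "inj (h \<circ> q)"
        by (rule inj_subsequence[of h, OF fin])
      have "range (h \<circ> q) \<subseteq> stabilizer G \<phi> \<xi>"
        using h by auto
      then have inf: "infinite (stabilizer G \<phi> \<xi>)"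
        using q(2) by (meson finite_subset range_inj_infinite)
      obtain p a b where p: "strict_mono (p :: nat \<Rightarrow> nat)" and c: "conv (h \<circ> p) a b"
        by (rule exists_conv_subsequence[of h, OF hG fin])
      have hp: "(h \<circ> p) n \<in> stabilizer G \<phi> \<xi>" for n
        using h by simp
      have ab: "a = \<xi>" "b = \<xi>"
        using stabilizer_attractor[OF \<xi>t \<xi>(2) c hp] stabilizer_repeller[OF \<xi>t \<xi>(2) c hp] by auto
      have "x = \<xi>"
      proof (rule ccontr)
        assume "x \<noteq> \<xi>"
        then have "limitin X (\<lambda>n. \<phi> ((h \<circ> p) n) ((\<eta> \<circ> p) n)) \<xi> sequentially"
          using conv_limit[OF c limq[OF p]] ab by blast
        then have "r \<le> d \<xi> \<xi>"
          using far_limit[OF p] by simp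
        then show False
          using \<open>r > 0\<close> \<xi>t by simp
      qed
      then show ?thesis
        using inf by blast
    qed
  qed
  \<comment> \<open>At \<xi> itself the first alternative of \<open>key\<close> fails, because the
    stabilizer fixes \<xi>.\<close>
  have inf: "infinite (stabilizer G \<phi> \<xi>)"
    using key[OF \<xi>(1)] \<xi>t \<open>r > 0\<close> stabilizerD(2) by fastforce
  have "limit_set X \<phi> (stabilizer G \<phi> \<xi>) = {\<xi>}"
  proof (intro equalityI subsetI)
    fix b
    assume "b \<in> limit_set X \<phi> (stabilizer G \<phi> \<xi>)"
    then obtain g a where "range g \<subseteq> stabilizer G \<phi> \<xi>" "conv g a b"
      using limit_set_iff[OF stabilizer_subset] by blast
    then show "b \<in> {\<xi>}"
      using stabilizer_attractor[OF \<xi>t \<xi>(2)] by (metis range_subsetD singletonI)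
  next
    fix b
    assume "b \<in> {\<xi>}"
    obtain s where s: "inj (s :: nat \<Rightarrow> 'g)" "range s \<subseteq> stabilizer G \<phi> \<xi>"
      using infinite_countable_subset[OF inf] by blast
    have sS: "s n \<in> stabilizer G \<phi> \<xi>" for n
      using s(2) by blast
    have fin: "finite {n. s n = g}" for g
      using finite_vimageI[of "{g}" s] s(1) by (simp add: vimage_def)
    obtain p a c where c: "conv (s \<circ> p) a c"
      by (rule exists_conv_subsequence[of s, OF stabilizerD(1)[OF sS] fin])
    have sp: "(s \<circ> p) n \<in> stabilizer G \<phi> \<xi>" for n
      using sS by simp
    have "c = \<xi>"
      by (rule stabilizer_attractor[OF \<xi>t \<xi>(2) c sp])
    then show "b \<in> limit_set X \<phi> (stabilizer G \<phi> \<xi>)"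
      using c sp \<open>b \<in> {\<xi>}\<close> limit_set_iff[OF stabilizer_subset] by blast
  qed
  then have parabolic: "parabolic_point G X \<phi> \<xi>"
    unfolding parabolic_point_def using \<xi>t inf by blast
  define K where "K = \<Lambda> - mball \<xi> r"
  have "closedin X K"
    unfolding K_def using closedin_limit_points openin_mball[of \<xi> r]
    by (simp add: mtopology_eq closedin_diff)
  then have "compactin X K"
    using compact closedin_compact_space by blast
  moreover have "K \<subseteq> \<Lambda> - {\<xi>}"
    using \<open>r > 0\<close> \<xi>t by (auto simp: K_def)
  moreover have "(\<Union>h\<in>stabilizer G \<phi> \<xi>. \<phi> h ` K) = \<Lambda> - {\<xi>}"
  proof (intro equalityI subsetI)
    fix x
    assume "x \<in> (\<Union>h\<in>stabilizer G \<phi> \<xi>. \<phi> h ` K)"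
    then obtain h k where h: "h \<in> stabilizer G \<phi> \<xi>" "k \<in> K" "x = \<phi> h k"
      by blast
    have k: "k \<in> \<Lambda>" "k \<noteq> \<xi>" "k \<in> topspace X"
      using h(2) \<open>K \<subseteq> \<Lambda> - {\<xi>}\<close> limit_points_subset by auto
    have "x \<in> \<Lambda>"
      using act_limit_points[OF stabilizerD(1)[OF h(1)] k(1)] h(3) by simp
    moreover have "x \<noteq> \<xi>"
      using act_eq_iff[OF stabilizerD(1)[OF h(1)] k(3) \<xi>t] k(2) stabilizerD(2)[OF h(1)] h(3) by simp
    ultimately show "x \<in> \<Lambda> - {\<xi>}"
      by blast
  next
    fix x
    assume x: "x \<in> \<Lambda> - {\<xi>}"
    then obtain h where h: "h \<in> stabilizer G \<phi> \<xi>" "r \<le> d \<xi> (\<phi> h x)"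
      using key by blast
    have hG: "h \<in> carrier G" and xt: "x \<in> topspace X"
      using stabilizerD(1)[OF h(1)] x limit_points_subset by auto
    have "\<phi> h x \<in> K"
      unfolding K_def using h(2) act_limit_points[OF hG, of x] x by auto
    moreover have "x = \<phi> (inv\<^bsub>G\<^esub> h) (\<phi> h x)"
      using hG xt by simp
    ultimately show "x \<in> (\<Union>h\<in>stabilizer G \<phi> \<xi>. \<phi> h ` K)"
      using stabilizer_m_inv_closed[OF \<xi>t h(1)] by blast
  qed
  ultimately show ?thesis
    unfolding bounded_parabolic_point_def acts_cocompactly_on_def using parabolic by blast
qed

text \<open>Suppose all distinct pairs in the orbit of \<open>\<xi>\<close> can be moved \<open>\<epsilon>\<close> apart, while there are
  orbit points \<open>\<eta> n\<close> whose whole \<open>G\<^sub>\<xi>\<close>-orbits tend to \<open>\<xi>\<close>. Only finitely many \<open>g\<close> move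
  \<open>\<xi>\<close> and \<open>\<eta> n\<close> apart by \<open>\<epsilon>/3\<close>; think of them as the places where the line from \<open>\<xi>\<close> to
  \<open>\<eta> n\<close> visits a fixed compact set, and let \<open>g n\<close> be the visit closest to \<open>\<xi>\<close>. The points
  \<open>g n \<xi>\<close> accumulate, and an element separating two of them yields an earlier visit.\<close>

lemma orbit_not_isolated:
  assumes \<xi>: "\<xi> \<in> \<Lambda>" "\<not> conical \<xi>" and nb: "\<not> bounded_parabolic_point G X \<phi> \<xi>" and "\<epsilon> > 0"
  shows "\<exists>\<eta>\<in>orbit G \<phi> \<xi> - {\<xi>}. \<forall>g\<in>carrier G. d (\<phi> g \<xi>) (\<phi> g \<eta>) < \<epsilon>"
proof (rule ccontr)
  assume neg: "\<not> ?thesis"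
  have sep0: "\<exists>g\<in>carrier G. \<epsilon> \<le> d (\<phi> g \<xi>) (\<phi> g \<eta>)" if \<eta>: "\<eta> \<in> orbit G \<phi> \<xi>" "\<eta> \<noteq> \<xi>" for \<eta>
  proof -
    have "\<exists>g\<in>carrier G. \<not> d (\<phi> g \<xi>) (\<phi> g \<eta>) < \<epsilon>"
      using neg \<eta> by blast
    then show ?thesis
      by (simp only: not_less)
  qed
  have \<xi>t: "\<xi> \<in> topspace X"
    using \<xi> limit_points_subset by blast
  have sep: "\<exists>g\<in>carrier G. \<epsilon> \<le> d (\<phi> g (\<phi> u \<xi>)) (\<phi> g (\<phi> v \<xi>))"
    if uv: "u \<in> carrier G" "v \<in> carrier G" "\<phi> u \<xi> \<noteq> \<phi> v \<xi>" for u v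
  proof -
    define \<eta> where "\<eta> = \<phi> (inv\<^bsub>G\<^esub> u) (\<phi> v \<xi>)"
    have "\<eta> \<in> orbit G \<phi> \<xi>"
      using uv \<xi>t orbit_act[of _ \<xi>] orbit_refl unfolding \<eta>_def by simp
    moreover have u\<eta>: "\<phi> u \<eta> = \<phi> v \<xi>"
      using uv \<xi>t by (simp add: \<eta>_def)
    moreover have "\<eta> \<noteq> \<xi>"
      using u\<eta> uv by auto
    ultimately obtain g where g: "g \<in> carrier G" "\<epsilon> \<le> d (\<phi> g \<xi>) (\<phi> g \<eta>)"
      using sep0 by blast
    have \<eta>t: "\<eta> \<in> topspace X"
      using uv \<xi>t by (simp add: \<eta>_def)
    have "\<phi> (g \<otimes>\<^bsub>G\<^esub> inv\<^bsub>G\<^esub> u) (\<phi> u \<xi>) = \<phi> g \<xi>" "\<phi> (g \<otimes>\<^bsub>G\<^esub> inv\<^bsub>G\<^esub> u) (\<phi> v \<xi>) = \<phi> g \<eta>"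
      using composition_rule uv g \<xi>t by (simp_all add: \<eta>_def)
    then show ?thesis
      using g(2) by (intro bexI[of _ "g \<otimes>\<^bsub>G\<^esub> inv\<^bsub>G\<^esub> u"]) (simp_all add: g(1) uv(1))
  qed
  \<comment> \<open>The distance left between an image at least \<open>\<epsilon> / 2\<close> from
    \<open>b'\<close> and one within \<open>\<epsilon> / 6\<close> of \<open>b'\<close>; see
    \<open>ufar\<close>.\<close>
  define \<epsilon>' where "\<epsilon>' = \<epsilon> / 3"
  have \<epsilon>': "\<epsilon>' > 0"
    using \<open>\<epsilon> > 0\<close> by (simp add: \<epsilon>'_def)
  \<comment> \<open>Every radius \<open>1/(n+1)\<close> must violate the hypothesis
    \<open>escape\<close> of \<open>bounded_parabolicI\<close>.\<close>
  have "\<exists>\<eta>. \<eta> \<in> orbit G \<phi> \<xi> \<and> \<eta> \<noteq> \<xi> \<and>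
      (\<forall>h\<in>stabilizer G \<phi> \<xi>. d \<xi> (\<phi> h \<eta>) < inverse (real (Suc n)))" for n
  proof (rule ccontr)
    assume neg': "\<not> ?thesis"
    have "\<exists>h\<in>stabilizer G \<phi> \<xi>. inverse (real (Suc n)) \<le> d \<xi> (\<phi> h \<eta>)"
      if \<eta>: "\<eta> \<in> orbit G \<phi> \<xi> - {\<xi>}" for \<eta>
    proof -
      have "\<exists>h\<in>stabilizer G \<phi> \<xi>. \<not> d \<xi> (\<phi> h \<eta>) < inverse (real (Suc n))"
        using neg' \<eta> by blast
      then show ?thesis
        by (simp only: not_less)
    qed
    then show False
      using bounded_parabolicI[OF \<xi>, of "inverse (real (Suc n))"] nb by simp
  qed
  then obtain \<eta> where \<eta>: "\<And>n. \<eta> n \<in> orbit G \<phi> \<xi>" "\<And>n. \<eta> n \<noteq> \<xi>"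
    and \<eta>stab: "\<And>n. \<forall>h\<in>stabilizer G \<phi> \<xi>. d \<xi> (\<phi> h (\<eta> n)) < inverse (real (Suc n))"
    by metis
  have \<eta>t: "\<eta> n \<in> topspace X" for n
    using \<eta>(1) orbit_subset_topspace[OF \<xi>t] by blast
  have \<eta>nc: "\<not> conical (\<eta> n)" for n
    using \<eta>(1)[of n] not_conical_act[OF _ \<xi>t \<xi>(2)] unfolding orbit_def by auto
  have one: "\<one>\<^bsub>G\<^esub> \<in> stabilizer G \<phi> \<xi>"
    using stabilizer_one_closed[OF \<xi>t] .
  have act_one: "\<phi> \<one>\<^bsub>G\<^esub> x = x" if "x \<in> topspace X" for x
    using fun_cong[OF id_eq_one, of x] that by simp
  have \<eta>lim: "limitin X (\<lambda>n. \<phi> (h (q n)) (\<eta> (q n))) \<xi> sequentially"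
    if "\<And>n. h (q n) \<in> stabilizer G \<phi> \<xi>" "strict_mono q" for h and q :: "nat \<Rightarrow> nat"
    unfolding limitin_dist_iff
  proof (intro conjI allI impI)
    fix e :: real
    assume "e > 0"
    with that(2) have "\<forall>\<^sub>F n in sequentially. inverse (real (Suc (q n))) < e"
      by (rule inverse_eventually_less)
    then show "\<forall>\<^sub>F n in sequentially. \<phi> (h (q n)) (\<eta> (q n)) \<in> topspace X \<and> d (\<phi> (h (q n)) (\<eta> (q n))) \<xi> < e"
    proof eventually_elim
      case (elim n)
      then show ?case
        using bspec[OF \<eta>stab[of "q n"] that(1)[of n]] stabilizerD(1)[OF that(1)[of n]] \<eta>t[of "q n"]
        by (simp add: commute)
    qed
  qed (rule \<xi>t)
  obtain z1 where z1: "z1 \<in> topspace X" "z1 \<noteq> \<xi>"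
    by (rule exists_third_point[of \<xi> \<xi>])
  obtain z2 where z2: "z2 \<in> topspace X" "z2 \<noteq> \<xi>" "z2 \<noteq> z1"
    by (rule exists_third_point[of \<xi> z1])
  define m where "m = min (d \<xi> z1) (min (d \<xi> z2) (d z1 z2))"
  have m: "m > 0" "m \<le> d \<xi> z1" "m \<le> d \<xi> z2" "m \<le> d z1 z2"
    using z1 z2 \<xi>t by (auto simp: m_def)
  \<comment> \<open>\<xi>, \<open>z1\<close> and \<open>z2\<close> are pairwise at least
    \<open>2 * \<delta>\<close> apart, so two open \<delta>-balls cannot contain all three; this
    gives \<open>cover\<close>.\<close>
  define \<delta> where "\<delta> = min (\<epsilon>' / 2) (m / 2)"
  have \<delta>: "\<delta> > 0" "2 * \<delta> \<le> \<epsilon>'" "2 * \<delta> \<le> m"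
    using m \<epsilon>' by (auto simp: \<delta>_def)
  have cover: "\<exists>z\<in>topspace X. \<delta> \<le> d x z \<and> \<delta> \<le> d y z" if "x \<in> topspace X" "y \<in> topspace X" for x y
  proof (rule ccontr)
    assume neg': "\<not> ?thesis"
    have *: "d x z < \<delta> \<or> d y z < \<delta>" if z: "z \<in> topspace X" for z
      using neg' z not_le by blast
    have "d z z' < m" if "d w z < \<delta>" "d w z' < \<delta>" "w \<in> topspace X" "z \<in> topspace X" "z' \<in> topspace X" for w z z'
      using triangle[OF that(4,3,5)] that commute[of z w] \<delta> by linarith
    then show False
      using *[OF \<xi>t] *[OF z1(1)] *[OF z2(1)] that z1(1) z2(1) \<xi>t m(2-4) not_le by metis
  qed
  define A where "A n = {g \<in> carrier G. \<epsilon>' \<le> d (\<phi> g \<xi>) (\<phi> g (\<eta> n))}" for n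
  \<comment> \<open>\<open>D g\<close> consists of the points that \<open>g\<close> leaves close to
    \<xi>: the smaller it is, the closer to \<xi> the visit. The closest visit is one with minimal
    \<open>D g\<close>, which exists because \<open>A n\<close> is finite.\<close>
  define D where "D g = {x \<in> topspace X. d (\<phi> g \<xi>) (\<phi> g x) < \<delta>}" for g
  have finA: "finite (A n)" for n
    unfolding A_def using finite_far_pairs[OF \<xi>t \<eta>t _ \<xi>(2) \<eta>nc \<epsilon>'] \<eta>(2)[of n] by auto
  have "\<exists>g. g \<in> A n \<and> (\<forall>u\<in>A n. \<not> D u \<subset> D g)" for n
  proof -
    have "\<epsilon>' \<le> \<epsilon>"
      using \<open>\<epsilon> > 0\<close> by (simp add: \<epsilon>'_def)
    then have "A n \<noteq> {}"
      using sep0[OF \<eta>(1)[of n] \<eta>(2)[of n]] order_trans unfolding A_def by blast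
    then obtain B where B: "B \<in> D ` A n" "\<forall>B'\<in>D ` A n. B' \<subseteq> B \<longrightarrow> B = B'"
      using finite_has_minimal[of "D ` A n"] finA[of n] by auto
    then obtain u where "u \<in> A n" "B = D u"
      by blast
    then show ?thesis
      using B(2) by (intro exI[of _ u]) auto
  qed
  then obtain g where gA: "\<And>n. g n \<in> A n" and gmin: "\<And>n u. u \<in> A n \<Longrightarrow> \<not> D u \<subset> D (g n)"
    by metis
  have gG: "g n \<in> carrier G" and gfar: "\<epsilon>' \<le> d (\<phi> (g n) \<xi>) (\<phi> (g n) (\<eta> n))" for n
    using gA[of n] by (auto simp: A_def)
  have limits_apart: "p \<noteq> q" if "strict_mono (r :: nat \<Rightarrow> nat)" "limitin X (\<lambda>n. \<phi> (g (r n)) \<xi>) p sequentially"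
    "limitin X (\<lambda>n. \<phi> (g (r n)) (\<eta> (r n))) q sequentially" for r p q
  proof
    assume "p = q"
    have e2: "\<epsilon>' / 2 > 0"
      using \<epsilon>' by simp
    have "\<forall>\<^sub>F n in sequentially. \<phi> (g (r n)) \<xi> \<in> topspace X \<and> d (\<phi> (g (r n)) \<xi>) p < \<epsilon>' / 2"
      using that(2) e2 unfolding limitin_dist_iff by blast
    moreover have "\<forall>\<^sub>F n in sequentially. \<phi> (g (r n)) (\<eta> (r n)) \<in> topspace X \<and> d (\<phi> (g (r n)) (\<eta> (r n))) q < \<epsilon>' / 2"
      using that(3) e2 unfolding limitin_dist_iff by blast
    ultimately have "\<forall>\<^sub>F n in sequentially. False"
    proof eventually_elim
      case (elim n)
      then show ?case
        using gfar[of "r n"] triangle[of "\<phi> (g (r n)) \<xi>" p "\<phi> (g (r n)) (\<eta> (r n))"] \<open>p = q\<close>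
          limitin_topspace[OF that(2)] commute[of p "\<phi> (g (r n)) (\<eta> (r n))"] by simp
    qed
    then show False
      by simp
  qed
  have \<eta>sub: "limitin X (\<lambda>n. \<eta> (r n)) \<xi> sequentially" if "strict_mono r" for r :: "nat \<Rightarrow> nat"
    using \<eta>lim[of "\<lambda>_. \<one>\<^bsub>G\<^esub>" r] one that act_one[OF \<eta>t] by simp
  have fin: "finite {n. g n = h}" for h
  proof (rule ccontr)
    assume "infinite {n. g n = h}"
    then obtain r where r: "strict_mono (r :: nat \<Rightarrow> nat)" "\<And>n. g (r n) = h"
      using infinite_enumerate by blast
    have "h \<in> carrier G"
      using gG[of "r 0"] r(2) by simp
    then have "limitin X (\<lambda>n. \<phi> h (\<eta> (r n))) (\<phi> h \<xi>) sequentially" "\<phi> h \<xi> \<in> topspace X"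
      using act_limit[OF _ \<eta>sub[OF r(1)]] \<xi>t by auto
    then show False
      using limits_apart[OF r(1), of "\<phi> h \<xi>" "\<phi> h \<xi>"] r(2) by simp
  qed
  obtain r1 a b where r1: "strict_mono (r1 :: nat \<Rightarrow> nat)" and c1: "conv (g \<circ> r1) a b"
    by (rule exists_conv_subsequence[of g, OF gG fin])
  obtain r2 p where r2: "strict_mono (r2 :: nat \<Rightarrow> nat)"
    and p2: "limitin X ((\<lambda>n. \<phi> (g (r1 n)) \<xi>) \<circ> r2) p sequentially"
    by (rule convergent_subsequence[of "\<lambda>n. \<phi> (g (r1 n)) \<xi>"]) (use gG \<xi>t in auto)
  obtain r3 q where r3: "strict_mono (r3 :: nat \<Rightarrow> nat)"
    and q3: "limitin X ((\<lambda>n. \<phi> (g (r1 (r2 n))) (\<eta> (r1 (r2 n)))) \<circ> r3) q sequentially"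
    by (rule convergent_subsequence[of "\<lambda>n. \<phi> (g (r1 (r2 n))) (\<eta> (r1 (r2 n)))"]) (use gG \<eta>t in auto)
  define r where "r = r1 \<circ> r2 \<circ> r3"
  have r: "strict_mono r"
    unfolding r_def using r1 r2 r3 by (intro strict_mono_o)
  have gr: "conv (\<lambda>n. g (r n)) a b"
    using conv_subsequence[OF conv_subsequence[OF c1 r2] r3] by (simp add: r_def o_def)
  have plim: "limitin X (\<lambda>n. \<phi> (g (r n)) \<xi>) p sequentially"
    using limitin_subsequence[OF r3 p2] by (simp add: r_def o_def)
  have qlim: "limitin X (\<lambda>n. \<phi> (g (r n)) (\<eta> (r n))) q sequentially"
    using q3 by (simp add: r_def o_def)
  have pt: "p \<in> topspace X" and qt: "q \<in> topspace X"
    using limitin_topspace[OF plim] limitin_topspace[OF qlim] by auto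
  have "p \<noteq> q"
    using limits_apart[OF r plim qlim] .
  \<comment> \<open>If \<open>\<phi> (g (r m)) \<xi>\<close> were constant for \<open>m > n\<close>,
    these \<open>g (r m)\<close> would differ from \<open>g (r n)\<close> by stabilizer elements,
    which by \<open>\<eta>stab\<close> bring \<eta> to \<xi>. Then the limits \<open>p\<close> and
    \<open>q\<close> would agree.\<close>
  have new: "\<exists>m>n. \<phi> (g (r m)) \<xi> \<noteq> \<phi> (g (r n)) \<xi>" for n
  proof (rule ccontr)
    assume "\<not> ?thesis"
    then have same: "\<phi> (g (r m)) \<xi> = \<phi> (g (r n)) \<xi>" if "m > n" for m
      using that by blast
    define s where "s m = Suc n + m" for m
    have s: "strict_mono s"
      by (simp add: s_def strict_mono_def)
    have "(\<lambda>m. \<phi> (g (r m)) \<xi>) \<circ> s = (\<lambda>m. \<phi> (g (r n)) \<xi>)"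
      using same by (simp add: s_def fun_eq_iff)
    then have "limitin X (\<lambda>m. \<phi> (g (r n)) \<xi>) p sequentially"
      using limitin_subsequence[OF s plim] by simp
    moreover have "limitin X (\<lambda>m. \<phi> (g (r n)) \<xi>) (\<phi> (g (r n)) \<xi>) sequentially"
      using gG \<xi>t by simp
    ultimately have p: "p = \<phi> (g (r n)) \<xi>"
      by (rule limit_unique)
    define k where "k i = inv\<^bsub>G\<^esub> (g (r n)) \<otimes>\<^bsub>G\<^esub> g i" for i
    have ks: "k ((r \<circ> s) m) \<in> stabilizer G \<phi> \<xi>" for m
      unfolding stabilizer_def k_def using composition_rule gG \<xi>t same[of "s m"] by (simp add: s_def)
    have "strict_mono (r \<circ> s)"
      using r s by (rule strict_mono_o)
    then have "limitin X (\<lambda>m. \<phi> (k ((r \<circ> s) m)) (\<eta> ((r \<circ> s) m))) \<xi> sequentially"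
      by (rule \<eta>lim[of k "r \<circ> s", OF ks])
    then have "limitin X (\<lambda>m. \<phi> (g (r n)) (\<phi> (k ((r \<circ> s) m)) (\<eta> ((r \<circ> s) m)))) (\<phi> (g (r n)) \<xi>) sequentially"
      by (rule act_limit[OF gG])
    moreover have "\<phi> (g (r n)) (\<phi> (k i) (\<eta> i)) = \<phi> (g i) (\<eta> i)" for i
      unfolding k_def using composition_rule gG \<eta>t by simp
    ultimately have "limitin X ((\<lambda>m. \<phi> (g (r m)) (\<eta> (r m))) \<circ> s) p sequentially"
      using p by (simp add: o_def)
    then show False
      using limit_unique[OF limitin_subsequence[OF s qlim]] \<open>p \<noteq> q\<close> by metis
  qed
  have "\<exists>m f. m > n \<and> f \<in> carrier G \<and> \<epsilon> \<le> d (\<phi> f (\<phi> (g (r n)) \<xi>)) (\<phi> f (\<phi> (g (r m)) \<xi>))" for n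
  proof -
    obtain m where m: "m > n" "\<phi> (g (r m)) \<xi> \<noteq> \<phi> (g (r n)) \<xi>"
      using new[of n] by blast
    then show ?thesis
      using sep[OF gG[of "r n"] gG[of "r m"]] by metis
  qed
  then obtain M f where M: "\<And>n. M n > n" and fG: "\<And>n. f n \<in> carrier G"
    and ffar: "\<And>n. \<epsilon> \<le> d (\<phi> (f n) (\<phi> (g (r n)) \<xi>)) (\<phi> (f n) (\<phi> (g (r (M n))) \<xi>))"
    by metis
  \<comment> \<open>\<open>M\<close> need not be monotone, so this is not a subsequence;
    \<open>M n > n\<close> suffices.\<close>
  have limM: "limitin X (\<lambda>n. y (M n)) l sequentially" if y: "limitin X y l sequentially" for y l
    unfolding limitin_dist_iff
  proof (intro conjI allI impI)
    fix e :: real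
    assume "e > 0"
    then obtain N where N: "\<And>n. n \<ge> N \<Longrightarrow> y n \<in> topspace X \<and> d (y n) l < e"
      using y unfolding limitin_dist_iff eventually_sequentially by blast
    have "y (M n) \<in> topspace X \<and> d (y (M n)) l < e" if "n \<ge> N" for n
      using N[of "M n"] M[of n] that by simp
    then show "\<forall>\<^sub>F n in sequentially. y (M n) \<in> topspace X \<and> d (y (M n)) l < e"
      unfolding eventually_sequentially by blast
  qed (rule limitin_topspace[OF y])
  have plimM: "limitin X (\<lambda>n. \<phi> (g (r (M n))) \<xi>) p sequentially"
    by (rule limM[OF plim])
  have qlimM: "limitin X (\<lambda>n. \<phi> (g (r (M n))) (\<eta> (r (M n)))) q sequentially"
    by (rule limM[OF qlim])
  have images_apart: False if "strict_mono (s :: nat \<Rightarrow> nat)"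
    "limitin X (\<lambda>n. \<phi> (f (s n)) (\<phi> (g (r (s n))) \<xi>)) l sequentially"
    "limitin X (\<lambda>n. \<phi> (f (s n)) (\<phi> (g (r (M (s n)))) \<xi>)) l sequentially" for s l
  proof -
    have e2: "\<epsilon> / 2 > 0"
      using \<open>\<epsilon> > 0\<close> by simp
    have "\<forall>\<^sub>F n in sequentially. \<phi> (f (s n)) (\<phi> (g (r (s n))) \<xi>) \<in> topspace X \<and>
        d (\<phi> (f (s n)) (\<phi> (g (r (s n))) \<xi>)) l < \<epsilon> / 2"
      using that(2) e2 unfolding limitin_dist_iff by blast
    moreover have "\<forall>\<^sub>F n in sequentially. \<phi> (f (s n)) (\<phi> (g (r (M (s n)))) \<xi>) \<in> topspace X \<and>
        d (\<phi> (f (s n)) (\<phi> (g (r (M (s n)))) \<xi>)) l < \<epsilon> / 2"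
      using that(3) e2 unfolding limitin_dist_iff by blast
    ultimately have "\<forall>\<^sub>F n in sequentially. False"
    proof eventually_elim
      case (elim n)
      then show ?case
        using ffar[of "s n"] limitin_topspace[OF that(2)]
          triangle[of "\<phi> (f (s n)) (\<phi> (g (r (s n))) \<xi>)" l "\<phi> (f (s n)) (\<phi> (g (r (M (s n)))) \<xi>)"]
          commute[of l "\<phi> (f (s n)) (\<phi> (g (r (M (s n)))) \<xi>)"] by simp
    qed
    then show False
      by simp
  qed
  have finf: "finite {n. f n = h}" for h
  proof (rule ccontr)
    assume "infinite {n. f n = h}"
    then obtain s where s: "strict_mono (s :: nat \<Rightarrow> nat)" "\<And>n. f (s n) = h"
      using infinite_enumerate by blast
    have h: "h \<in> carrier G"
      using fG[of "s 0"] s(2) by simp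
    have "limitin X (\<lambda>n. \<phi> h (\<phi> (g (r (s n))) \<xi>)) (\<phi> h p) sequentially"
      using act_limit[OF h limitin_subsequence[OF s(1) plim]] by (simp add: o_def)
    moreover have "limitin X (\<lambda>n. \<phi> h (\<phi> (g (r (M (s n)))) \<xi>)) (\<phi> h p) sequentially"
      using act_limit[OF h limitin_subsequence[OF s(1) plimM]] by (simp add: o_def)
    ultimately show False
      using images_apart[OF s(1), of "\<phi> h p"] s(2) by simp
  qed
  obtain s a' b' where s: "strict_mono (s :: nat \<Rightarrow> nat)" and cf: "conv (f \<circ> s) a' b'"
    by (rule exists_conv_subsequence[of f, OF fG finf])
  have plims: "limitin X ((\<lambda>n. \<phi> (g (r n)) \<xi>) \<circ> s) p sequentially"
    and plimMs: "limitin X ((\<lambda>n. \<phi> (g (r (M n))) \<xi>) \<circ> s) p sequentially"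
    and qlims: "limitin X ((\<lambda>n. \<phi> (g (r n)) (\<eta> (r n))) \<circ> s) q sequentially"
    and qlimMs: "limitin X ((\<lambda>n. \<phi> (g (r (M n))) (\<eta> (r (M n)))) \<circ> s) q sequentially"
    using limitin_subsequence[OF s plim] limitin_subsequence[OF s plimM]
      limitin_subsequence[OF s qlim] limitin_subsequence[OF s qlimM] by auto
  have bt: "b' \<in> topspace X"
    using conv_topspace[OF cf] by simp
  have "a' = p"
  proof (rule ccontr)
    assume "a' \<noteq> p"
    then show False
      using images_apart[OF s, of b'] conv_limit[OF cf plims] conv_limit[OF cf plimMs]
      by (simp add: o_def)
  qed
  then have "q \<noteq> a'"
    using \<open>p \<noteq> q\<close> by blast
  \<comment> \<open>\<open>\<delta> / 2\<close> is needed in \<open>inD\<close>,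
    \<open>\<epsilon> / 6\<close> in \<open>ufar\<close>.\<close>
  define \<kappa> where "\<kappa> = min (\<delta> / 2) (\<epsilon> / 6)"
  have \<kappa>: "\<kappa> > 0" "\<kappa> \<le> \<delta> / 2" "\<kappa> \<le> \<epsilon> / 6"
    using \<delta> \<open>\<epsilon> > 0\<close> by (auto simp: \<kappa>_def)
  have d2: "\<delta> / 2 > 0"
    using \<delta> by simp
  have e1: "\<forall>\<^sub>F n in sequentially. \<forall>x\<in>topspace X. \<delta> / 2 \<le> d p x \<longrightarrow> d b' (\<phi> ((f \<circ> s) n) x) < \<delta> / 2"
    using cf d2 unfolding conv_def \<open>a' = p\<close> by blast
  have e2: "\<forall>\<^sub>F n in sequentially. ((\<lambda>n. \<phi> (g (r n)) \<xi>) \<circ> s) n \<in> topspace X \<and> d (((\<lambda>n. \<phi> (g (r n)) \<xi>) \<circ> s) n) p < \<delta> / 2"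
    using plims d2 unfolding limitin_dist_iff by blast
  have e3: "\<forall>\<^sub>F n in sequentially. ((\<lambda>n. \<phi> (g (r (M n))) \<xi>) \<circ> s) n \<in> topspace X \<and> d (((\<lambda>n. \<phi> (g (r (M n))) \<xi>) \<circ> s) n) p < \<delta> / 2"
    using plimMs d2 unfolding limitin_dist_iff by blast
  have e4: "\<forall>\<^sub>F n in sequentially. \<phi> ((f \<circ> s) n) (((\<lambda>n. \<phi> (g (r n)) (\<eta> (r n))) \<circ> s) n) \<in> topspace X \<and>
      d (\<phi> ((f \<circ> s) n) (((\<lambda>n. \<phi> (g (r n)) (\<eta> (r n))) \<circ> s) n)) b' < \<kappa>"
    using conv_limit[OF cf qlims \<open>q \<noteq> a'\<close>] \<kappa>(1) unfolding limitin_dist_iff by blast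
  have e5: "\<forall>\<^sub>F n in sequentially. \<phi> ((f \<circ> s) n) (((\<lambda>n. \<phi> (g (r (M n))) (\<eta> (r (M n)))) \<circ> s) n) \<in> topspace X \<and>
      d (\<phi> ((f \<circ> s) n) (((\<lambda>n. \<phi> (g (r (M n))) (\<eta> (r (M n)))) \<circ> s) n)) b' < \<kappa>"
    using conv_limit[OF cf qlimMs \<open>q \<noteq> a'\<close>] \<kappa>(1) unfolding limitin_dist_iff by blast
  have "\<forall>\<^sub>F n in sequentially. False"
    using e1 e2 e3 e4 e5
  proof eventually_elim
    case (elim n)
    define h where "h = f (s n)"
    have h: "h \<in> carrier G"
      using fG by (simp add: h_def)
    have contract: "d b' (\<phi> h x) < \<delta> / 2" if "x \<in> topspace X" "\<delta> / 2 \<le> d p x" for x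
      using elim(1) that by (simp add: h_def)
    \<comment> \<open>\<open>h\<close> moves two points near \<open>p\<close> at least \<epsilon>
      apart, so one image is at least \<open>\<epsilon> / 2\<close> from \<open>b'\<close>;
      \<open>j\<close> is the index of that point.\<close>
    obtain j where j: "d (\<phi> (g j) \<xi>) p < \<delta> / 2" "d (\<phi> h (\<phi> (g j) (\<eta> j))) b' < \<kappa>"
      and jfar: "\<epsilon> / 2 \<le> d (\<phi> h (\<phi> (g j) \<xi>)) b'"
    proof -
      have "\<phi> h (\<phi> (g (r (s n))) \<xi>) \<in> topspace X" "\<phi> h (\<phi> (g (r (M (s n)))) \<xi>) \<in> topspace X"
        using h gG \<xi>t by auto
      then have "\<epsilon> \<le> d (\<phi> h (\<phi> (g (r (s n))) \<xi>)) b' + d (\<phi> h (\<phi> (g (r (M (s n)))) \<xi>)) b'"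
        using ffar[of "s n"] triangle[OF _ bt] commute[of b'] unfolding h_def by (metis order_trans)
      then consider "\<epsilon> / 2 \<le> d (\<phi> h (\<phi> (g (r (s n))) \<xi>)) b'" | "\<epsilon> / 2 \<le> d (\<phi> h (\<phi> (g (r (M (s n)))) \<xi>)) b'"
        by linarith
      then show thesis
      proof cases
        case 1
        then show ?thesis
          using that[of "r (s n)"] elim(2,4) by (simp add: h_def)
      next
        case 2
        then show ?thesis
          using that[of "r (M (s n))"] elim(3,5) by (simp add: h_def)
      qed
    qed
    \<comment> \<open>This is the earlier visit: \<open>u\<close> still separates \<xi> from
      \<open>\<eta> j\<close>, but \<open>D u\<close> is strictly smaller than
      \<open>D (g j)\<close>.\<close>
    define u where "u = h \<otimes>\<^bsub>G\<^esub> g j"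
    have uG: "u \<in> carrier G"
      using h gG by (simp add: u_def)
    have u: "\<phi> u x = \<phi> h (\<phi> (g j) x)" if "x \<in> topspace X" for x
      unfolding u_def using composition_rule[OF that h gG] .
    have ut: "\<phi> u \<xi> \<in> topspace X" "\<phi> u (\<eta> j) \<in> topspace X"
      using uG \<xi>t \<eta>t by auto
    have u\<xi>: "\<epsilon> / 2 \<le> d (\<phi> u \<xi>) b'" and u\<eta>: "d (\<phi> u (\<eta> j)) b' < \<kappa>"
      using j jfar u \<xi>t \<eta>t by auto
    have ufar: "\<epsilon>' \<le> d (\<phi> u \<xi>) (\<phi> u (\<eta> j))"
      using triangle[OF ut bt] u\<xi> u\<eta> \<kappa>(3) by (simp add: \<epsilon>'_def)
    then have "u \<in> A j"
      using uG by (simp add: A_def)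
    \<comment> \<open>\<open>z\<close> makes the inclusion strict: far from \<xi> under
      \<open>u\<close> it is outside \<open>D u\<close>, far from \<open>\<eta> j\<close> it is
      inside \<open>D (g j)\<close> by \<open>inD\<close>.\<close>
    obtain z where z: "z \<in> topspace X" "\<delta> \<le> d (\<phi> u \<xi>) (\<phi> u z)" "\<delta> \<le> d (\<phi> u (\<eta> j)) (\<phi> u z)"
    proof -
      obtain w where w: "w \<in> topspace X" "\<delta> \<le> d (\<phi> u \<xi>) w" "\<delta> \<le> d (\<phi> u (\<eta> j)) w"
        using cover[OF ut] by blast
      then show thesis
        using that[of "\<phi> (inv\<^bsub>G\<^esub> u) w"] uG by simp
    qed
    \<comment> \<open>A point outside \<open>D (g j)\<close> is sent by \<open>g j\<close> away from
      \<open>p\<close>, so \<open>h\<close> contracts it into the \<open>\<delta> / 2\<close>-ball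
      around \<open>b'\<close>, which also contains \<open>\<phi> u (\<eta> j)\<close>.\<close>
    have inD: "x \<in> D (g j)" if x: "x \<in> topspace X" "\<delta> \<le> d (\<phi> u (\<eta> j)) (\<phi> u x)" for x
    proof (rule ccontr)
      assume "x \<notin> D (g j)"
      then have "\<delta> \<le> d (\<phi> (g j) \<xi>) (\<phi> (g j) x)"
        using x by (simp add: D_def)
      moreover have gt: "\<phi> (g j) \<xi> \<in> topspace X" "\<phi> (g j) x \<in> topspace X"
        using gG \<xi>t x by auto
      ultimately have "\<delta> / 2 \<le> d p (\<phi> (g j) x)"
        using triangle[OF gt(1) pt gt(2)] j(1) by simp
      then have "d b' (\<phi> u x) < \<delta> / 2"
        using contract[OF gt(2)] u[OF x(1)] by simp
      then have "d (\<phi> u (\<eta> j)) (\<phi> u x) < \<delta>"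
        using triangle[OF ut(2) bt, of "\<phi> u x"] u\<eta> \<kappa>(2) uG x by simp
      then show False
        using x by simp
    qed
    have "D u \<subseteq> D (g j)"
    proof
      fix x
      assume "x \<in> D u"
      then have x: "x \<in> topspace X" "d (\<phi> u \<xi>) (\<phi> u x) < \<delta>"
        by (auto simp: D_def)
      have xt: "\<phi> u x \<in> topspace X"
        using uG x by simp
      have "\<delta> \<le> d (\<phi> u (\<eta> j)) (\<phi> u x)"
        using triangle[OF ut(1) xt ut(2)] x(2) ufar \<delta>(2) commute[of "\<phi> u x" "\<phi> u (\<eta> j)"] by linarith
      then show "x \<in> D (g j)"
        using inD x(1) by blast
    qed
    moreover have "z \<in> D (g j)"
      using inD z by blast
    moreover have "z \<notin> D u"
      using z by (simp add: D_def)
    ultimately have "D u \<subset> D (g j)"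
      by blast
    then show ?case
      using gmin[OF \<open>u \<in> A j\<close>] by blast
  qed
  then show False
    by simp
qed

subsection \<open>The invariant metric\<close>

text \<open>Outside of the space the supremum could be a junk value, hence the case distinction.\<close>

definition orbit_dist :: "'m \<Rightarrow> 'm \<Rightarrow> real" where
  "orbit_dist x y =
    (if x \<in> topspace X \<and> y \<in> topspace X then SUP g\<in>carrier G. d (\<phi> g x) (\<phi> g y) else 0)"

lemma dist_le_orbit_dist:
  assumes "g \<in> carrier G" "x \<in> topspace X" "y \<in> topspace X"
  shows "d (\<phi> g x) (\<phi> g y) \<le> orbit_dist x y"
proof -
  have "compactin mtopology (topspace X)"
    using compact by (simp add: mtopology_eq compact_space_def)
  then obtain B where "\<forall>x\<in>topspace X. \<forall>y\<in>topspace X. d x y \<le> B"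
    using compactin_imp_mbounded mbounded_alt by blast
  then have "bdd_above ((\<lambda>g. d (\<phi> g x) (\<phi> g y)) ` carrier G)"
    using assms by (intro bdd_aboveI2[of _ _ B]) simp
  then show ?thesis
    using cSUP_upper[OF assms(1)] assms(2,3) by (simp add: orbit_dist_def)
qed

lemma orbit_dist_le:
  assumes "x \<in> topspace X" "y \<in> topspace X" "\<And>g. g \<in> carrier G \<Longrightarrow> d (\<phi> g x) (\<phi> g y) \<le> e"
  shows "orbit_dist x y \<le> e"
proof -
  have "carrier G \<noteq> {}"
    using one_closed by blast
  then show ?thesis
    using assms by (simp add: orbit_dist_def cSUP_least)
qed

lemma dist_le_orbit_dist': "x \<in> topspace X \<Longrightarrow> y \<in> topspace X \<Longrightarrow> d x y \<le> orbit_dist x y"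
  using dist_le_orbit_dist[of "\<one>\<^bsub>G\<^esub>" x y] fun_cong[OF id_eq_one, of x] fun_cong[OF id_eq_one, of y]
  by simp

lemma Metric_space_orbit_dist: "Metric_space (topspace X) orbit_dist"
proof
  fix x y z
  show "orbit_dist x y = orbit_dist y x"
    by (simp add: orbit_dist_def commute)
  show "0 \<le> orbit_dist x y"
  proof (cases "x \<in> topspace X \<and> y \<in> topspace X")
    case True
    then show ?thesis
      using dist_le_orbit_dist'[of x y] nonneg[of x y] by linarith
  next
    case False
    then show ?thesis
      by (auto simp: orbit_dist_def)
  qed
  assume x: "x \<in> topspace X" and y: "y \<in> topspace X"
  show "orbit_dist x y = 0 \<longleftrightarrow> x = y"
  proof
    assume "orbit_dist x y = 0"
    then have "d x y \<le> 0"
      using dist_le_orbit_dist'[OF x y] by simp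
    then show "x = y"
      using x y nonneg[of x y] by simp
  next
    assume "x = y"
    have "orbit_dist x x \<le> 0"
      using x by (intro orbit_dist_le) auto
    then show "orbit_dist x y = 0"
      using \<open>0 \<le> orbit_dist x y\<close> \<open>x = y\<close> by simp
  qed
  assume z: "z \<in> topspace X"
  show "orbit_dist x z \<le> orbit_dist x y + orbit_dist y z"
  proof (rule orbit_dist_le[OF x z])
    fix g
    assume g: "g \<in> carrier G"
    then show "d (\<phi> g x) (\<phi> g z) \<le> orbit_dist x y + orbit_dist y z"
      using triangle[of "\<phi> g x" "\<phi> g y" "\<phi> g z"] dist_le_orbit_dist[OF g x y]
        dist_le_orbit_dist[OF g y z] x y z by simp
  qed
qed

lemma orbit_dist_act_le:
  assumes g: "g \<in> carrier G" and x: "x \<in> topspace X" and y: "y \<in> topspace X"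
  shows "orbit_dist (\<phi> g x) (\<phi> g y) \<le> orbit_dist x y"
proof (rule orbit_dist_le)
  fix h
  assume h: "h \<in> carrier G"
  show "d (\<phi> h (\<phi> g x)) (\<phi> h (\<phi> g y)) \<le> orbit_dist x y"
    using dist_le_orbit_dist[OF m_closed[OF h g] x y] composition_rule[OF x h g]
      composition_rule[OF y h g] by simp
qed (use assms in auto)

lemma limit_dist_le:
  assumes lim: "limitin X y l sequentially" and u: "u \<in> topspace X"
    and le: "\<And>n. n \<ge> N \<Longrightarrow> d u (y n) \<le> e"
  shows "d u l \<le> e"
proof (rule ccontr)
  assume "\<not> ?thesis"
  then have "d u l - e > 0"
    by simp
  then obtain N' where N': "\<And>n. n \<ge> N' \<Longrightarrow> y n \<in> topspace X \<and> d (y n) l < d u l - e"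
    using lim unfolding limitin_dist_iff eventually_sequentially by blast
  show False
    using N'[of "max N N'"] le[of "max N N'"] triangle[OF u _ limitin_topspace[OF lim], of "y (max N N')"]
    by simp
qed

text \<open>Compactness gives a candidate limit for \<open>d\<close>. Each \<open>g\<close> is
  continuous, so the Cauchy estimate for \<open>\<phi> g\<close> passes to the limit with a bound
  independent of \<open>g\<close>, and hence to the supremum.\<close>

lemma mcomplete_orbit_dist: "Metric_space.mcomplete (topspace X) orbit_dist"
proof -
  interpret T: Metric_space "topspace X" orbit_dist
    by (rule Metric_space_orbit_dist)
  show ?thesis
    unfolding T.mcomplete_def
  proof (intro allI impI)
    fix \<sigma>
    assume "T.MCauchy \<sigma>"
    then have "range \<sigma> \<subseteq> topspace X"
      and cauchy: "\<And>e. e > 0 \<Longrightarrow> \<exists>N. \<forall>n n'. N \<le> n \<longrightarrow> N \<le> n' \<longrightarrow> orbit_dist (\<sigma> n) (\<sigma> n') < e"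
      unfolding T.MCauchy_def by auto
    then have \<sigma>: "\<sigma> n \<in> topspace X" for n
      by auto
    obtain r l where r: "strict_mono (r :: nat \<Rightarrow> nat)" and l: "limitin X (\<sigma> \<circ> r) l sequentially"
      by (rule convergent_subsequence[of \<sigma>, OF \<sigma>])
    have lt: "l \<in> topspace X"
      using l by (rule limitin_topspace)
    have "limitin T.mtopology \<sigma> l sequentially"
      unfolding T.limit_metric_sequentially
    proof (intro conjI allI impI)
      fix e :: real
      assume "e > 0"
      then obtain N where N: "\<And>n n'. N \<le> n \<Longrightarrow> N \<le> n' \<Longrightarrow> orbit_dist (\<sigma> n) (\<sigma> n') < e / 2"
        using cauchy[of "e / 2"] by auto
      have "\<sigma> n \<in> topspace X \<and> orbit_dist (\<sigma> n) l < e" if n: "N \<le> n" for n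
      proof -
        have "orbit_dist (\<sigma> n) l \<le> e / 2"
        proof (rule orbit_dist_le[OF \<sigma> lt])
          fix g
          assume g: "g \<in> carrier G"
          show "d (\<phi> g (\<sigma> n)) (\<phi> g l) \<le> e / 2"
          proof (rule limit_dist_le[OF act_limit[OF g l]])
            fix k
            assume "N \<le> k"
            also have "k \<le> r k"
              using r by (rule seq_suble)
            finally show "d (\<phi> g (\<sigma> n)) (\<phi> g ((\<sigma> \<circ> r) k)) \<le> e / 2"
              using dist_le_orbit_dist[OF g \<sigma> \<sigma>, of n "r k"] N[OF n, of "r k"] by simp
          qed (use g \<sigma> in simp)
        qed
        then show ?thesis
          using \<sigma> \<open>e > 0\<close> by simp
      qed
      then show "\<exists>N. \<forall>n\<ge>N. \<sigma> n \<in> topspace X \<and> orbit_dist (\<sigma> n) l < e"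
        by blast
    qed (rule lt)
    then show "\<exists>l. limitin T.mtopology \<sigma> l sequentially"
      by blast
  qed
qed

lemma not_bounded_parabolic_imp_uncountable:
  assumes \<xi>: "\<xi> \<in> \<Lambda>" "\<not> conical \<xi>" and nb: "\<not> bounded_parabolic_point G X \<phi> \<xi>"
  shows "uncountable {\<xi> \<in> \<Lambda>. \<not> conical \<xi>}"
proof -
  interpret T: Metric_space "topspace X" orbit_dist
    by (rule Metric_space_orbit_dist)
  let ?O = "orbit G \<phi> \<xi>"
  have \<xi>t: "\<xi> \<in> topspace X"
    using \<xi> limit_points_subset by blast
  have Ot: "?O \<subseteq> topspace X"
    using orbit_subset_topspace[OF \<xi>t] .
  have O\<Lambda>: "\<eta> \<in> \<Lambda>" "\<not> conical \<eta>" if "\<eta> \<in> ?O" for \<eta>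
    using that act_limit_points[OF _ \<xi>(1)] not_conical_act[OF _ \<xi>t \<xi>(2)] unfolding orbit_def by auto
  \<comment> \<open>A derived set is closed; once it contains \<open>?O\<close>, monotonicity shows
    that it has no isolated points either.\<close>
  define D where "D = T.mtopology derived_set_of ?O"
  have D_iff: "x \<in> D \<longleftrightarrow> x \<in> topspace X \<and> (\<forall>r>0. \<exists>y\<in>?O. y \<noteq> x \<and> y \<in> T.mball x r)" for x
    unfolding D_def T.metric_derived_set_of by simp
  have "?O \<subseteq> D"
  proof
    fix x
    assume "x \<in> ?O"
    then obtain u where u: "u \<in> carrier G" "x = \<phi> u \<xi>"
      unfolding orbit_def by blast
    have "\<exists>y\<in>?O. y \<noteq> x \<and> y \<in> T.mball x r" if "r > 0" for r
    proof -
      \<comment> \<open>Strict bounds for all \<open>g\<close> give only a weak bound for the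
        supremum, hence half of \<open>r\<close>.\<close>
      have "r / 2 > 0"
        using that by simp
      then obtain \<eta> where \<eta>: "\<eta> \<in> ?O" "\<eta> \<noteq> \<xi>" "\<forall>g\<in>carrier G. d (\<phi> g \<xi>) (\<phi> g \<eta>) < r / 2"
        using orbit_not_isolated[OF \<xi> nb] by blast
      have \<eta>t: "\<eta> \<in> topspace X"
        using \<eta>(1) Ot by blast
      have "orbit_dist \<xi> \<eta> \<le> r / 2"
        using \<eta>(3) by (intro orbit_dist_le[OF \<xi>t \<eta>t]) (auto intro: less_imp_le)
      then have "orbit_dist x (\<phi> u \<eta>) < r"
        using orbit_dist_act_le[OF u(1) \<xi>t \<eta>t] that u(2) by simp
      then have "\<phi> u \<eta> \<in> T.mball x r"
        using u \<xi>t \<eta>t by simp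
      moreover have "\<phi> u \<eta> \<noteq> x"
        using act_eq_iff[OF u(1) \<eta>t \<xi>t] \<eta>(2) u(2) by simp
      ultimately show ?thesis
        using orbit_act[OF u(1) \<xi>t \<eta>(1)] by blast
    qed
    then show "x \<in> D"
      unfolding D_iff using \<open>x \<in> ?O\<close> Ot by blast
  qed
  have "closedin T.mtopology D"
    unfolding D_def by (rule closedin_derived_set_of[OF T.Hausdorff_space_mtopology])
  then have "T.mtopology derived_set_of D \<subseteq> D"
    by (simp add: closedin_contains_derived_set)
  moreover have "D \<subseteq> T.mtopology derived_set_of D"
    using derived_set_of_mono[OF \<open>?O \<subseteq> D\<close>, of T.mtopology] by (simp only: D_def[symmetric])
  ultimately have perfect: "T.mtopology derived_set_of D = D"
    by (rule subset_antisym)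
  have "D \<noteq> {}"
    using \<open>?O \<subseteq> D\<close> orbit_refl[OF \<xi>t] by blast
  have "(UNIV :: real set) \<lesssim> D"
    by (rule T.lepoll_perfect_set[OF mcomplete_orbit_dist perfect \<open>D \<noteq> {}\<close>])
  then have "uncountable D"
    using countable_lepoll uncountable_UNIV_real by blast
  moreover have "D \<subseteq> {\<xi> \<in> \<Lambda>. \<not> conical \<xi>}"
  proof
    fix x
    assume "x \<in> D"
    then have xt: "x \<in> topspace X"
      and approx: "\<And>r. r > 0 \<Longrightarrow> \<exists>y\<in>?O. y \<noteq> x \<and> orbit_dist x y < r"
      unfolding D_iff by (blast, force)
    have "\<exists>y\<in>?O. orbit_dist x y < inverse (real (Suc n))" for n
      using approx[of "inverse (real (Suc n))"] by auto
    then obtain y where y: "\<And>n. y n \<in> ?O" "\<And>n. orbit_dist x (y n) < inverse (real (Suc n))"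
      by metis
    have "limitin X y x sequentially"
      unfolding limitin_dist_iff
    proof (intro conjI allI impI)
      fix e :: real
      assume "e > 0"
      then have "\<forall>\<^sub>F n in sequentially. inverse (real (Suc (id n))) < e"
        by (intro inverse_eventually_less) (auto simp: strict_mono_def)
      then show "\<forall>\<^sub>F n in sequentially. y n \<in> topspace X \<and> d (y n) x < e"
      proof eventually_elim
        case (elim n)
        have "y n \<in> topspace X"
          using y(1) Ot by blast
        then show ?case
          using elim y(2)[of n] dist_le_orbit_dist'[OF xt, of "y n"] by (simp add: commute)
      qed
    qed (rule xt)
    then have "x \<in> \<Lambda>"
      using O\<Lambda>(1)[OF y(1)] by (rule limit_points_closed[rotated])
    moreover have "\<not> conical x"
    proof
      assume "conical x"
      then obtain g b c where g: "conv g x b"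
        and c: "limitin X (\<lambda>n. \<phi> (g n) x) c sequentially" and "c \<noteq> b"
        unfolding conical_point_def by (auto simp: convergence_sequence_iff)
      have bc: "b \<in> topspace X" "c \<in> topspace X"
        using conv_topspace[OF g] limitin_topspace[OF c] by auto
      \<comment> \<open>\<open>w\<close> is not the repelling point \<open>x\<close>, so it is
        carried to \<open>b\<close>, yet it stays within \<open>e\<close> of the images of
        \<open>x\<close>, which tend to \<open>c\<close>. Three distances below \<open>e\<close>
        cannot add up to \<open>d b c\<close>.\<close>
      define e where "e = d b c / 3"
      have "e > 0"
        using bc \<open>c \<noteq> b\<close> by (simp add: e_def)
      then obtain w where w: "w \<in> ?O" "w \<noteq> x" "orbit_dist x w < e"
        using approx by blast
      have wt: "w \<in> topspace X"
        using w Ot by blast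
      have "\<forall>\<^sub>F n in sequentially. \<phi> (g n) w \<in> topspace X \<and> d (\<phi> (g n) w) b < e"
        using conv_limit_const[OF g wt w(2)] \<open>e > 0\<close> unfolding limitin_dist_iff by blast
      moreover have "\<forall>\<^sub>F n in sequentially. \<phi> (g n) x \<in> topspace X \<and> d (\<phi> (g n) x) c < e"
        using c \<open>e > 0\<close> unfolding limitin_dist_iff by blast
      ultimately have "\<forall>\<^sub>F n in sequentially. False"
      proof eventually_elim
        case (elim n)
        have "d (\<phi> (g n) x) (\<phi> (g n) w) < e"
          using dist_le_orbit_dist[OF conv_carrier[OF g] xt wt] w(3) by (rule le_less_trans)
        then show ?case
          using elim triangle[of b "\<phi> (g n) w" c] triangle[of "\<phi> (g n) w" "\<phi> (g n) x" c] bc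
            commute[of b "\<phi> (g n) w"] commute[of "\<phi> (g n) x" "\<phi> (g n) w"]
          by (simp add: e_def)
      qed
      then show False
        by simp
    qed
    ultimately show "x \<in> {\<xi> \<in> \<Lambda>. \<not> conical \<xi>}"
      by blast
  qed
  ultimately show ?thesis
    using countable_subset by blast
qed

end

theorem theorem1p2:
  fixes G :: "('g, 'c) monoid_scheme" and X :: "'m topology" and \<phi> :: "'g \<Rightarrow> 'm \<Rightarrow> 'm"
  assumes "convergence_action G X \<phi>"
    and "metrizable_space X"
    and "non_elementary G X \<phi>"
  shows "geometrically_infinite G X \<phi> \<longleftrightarrow>
    uncountable {\<xi> \<in> limit_set X \<phi> (carrier G). \<not> conical_point G X \<phi> \<xi>}"
proof -
  obtain M d where M: "Metric_space M d" and X: "X = Metric_space.mtopology M d"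
    using assms(2) unfolding metrizable_space_def by blast
  then have "topspace X = M"
    by (simp add: Metric_space.topspace_mtopology)
  then interpret nonelementary_metric_action G X \<phi> d
    using assms M X
    by (simp add: nonelementary_metric_action_def nonelementary_metric_action_axioms_def
        metric_convergence_action_def metric_convergence_action_axioms_def)
  show ?thesis
    using geometrically_finite_imp_countable not_bounded_parabolic_imp_uncountable
    unfolding geometrically_finite_def by blast
qed

end
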